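(* Let $\ell\ge0$, let $m_0\in\mathcal P_\ell(\mathbb R^d)$ be discrete and, for $N\ge1$, let $m^N=\frac1N\sum_{i=1}^N\delta_{\zeta_i}$, where $\zeta_1,\zeta_2,\ldots$ are i.i.d. $\mathbb R^d$-valued random variables with law $m_0$. Suppose that $U\in\mathcal S_{1,\ell/2}(\mathcal P_\ell(\mathbb R^d))\cap\mathcal S_{2,\ell}(\mathcal P_\ell(\mathbb R^d))$ is such that there exists $C<\infty$ with, for all $(\mu,x,y)\in\mathcal P_\ell(\mathbb R^d)\times\mathbb R^d\times\mathbb R^d$, $$\left|\frac{\delta^2U}{\delta m^2}(\mu,x,y)\right|\le C\left(1+|x|^{\ell/2}+|y|^\ell+\int_{\mathbb R^d}|z|^\ell\mu(dz)\right).$$ Then, as $N\to\infty$, $$\sqrt N\left(U(m^N)-U(m_0)\right)\Longrightarrow\mathcal N\left(0,\ \mathrm{Var}\left(\frac{\delta U}{\delta m}(m_0,\zeta_1)\right)\right)$$ in distribution. Furthermore, $$\sup_{N\in\mathbb N}\sqrt N\,\mathbb E\left|U(m^N)-U(m_0)\right|<\infty.$$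
   Context: For $\ell\ge0$, $\mathcal P_\ell(\mathbb R^d)$ is the set of Borel probability measures $m$ on $\mathbb R^d$ with $\int|x|^\ell m(dx)<\infty$. For $\ell>0$, $W_\ell(\mu_1,\mu_2)=\inf_\rho\left(\int|x-y|^\ell\rho(dx,dy)\right)^{1/(\ell\vee1)}$ and $W_0(\mu_1,\mu_2)=\inf_\rho\int1_{\{x\ne y\}}\rho(dx,dy)$, infima over couplings $\rho$ of $\mu_1,\mu_2\in\mathcal P_\ell(\mathbb R^d)$. $m_0$ is discrete if it is concentrated on a countable set. Linear functional derivatives: $U:\mathcal P_\ell(\mathbb R^d)\to\mathbb R$ admits a linear functional derivative at $\mu$ if there is a measurable $y\mapsto\frac{\delta U}{\delta m}(\mu,y)\in\mathbb R$ with $\sup_y\left|\frac{\delta U}{\delta m}(\mu,y)\right|/(1+|y|^\ell)<\infty$ and $\frac{d}{d\varepsilon}\big|_{\varepsilon=0^+}U(\mu+\varepsilon(\nu-\mu))=\int\frac{\delta U}{\delta m}(\mu,y)(\nu-\mu)(dy)$ for all $\nu\in\mathcal P_\ell(\mathbb R^d)$. Inductively, for $j\ge2$, if $U$ admits a $(j-1)$-th order derivative $\frac{\delta^{j-1}U}{\delta m^{j-1}}(m,\mathbf y)$, $\mathbf y\in(\mathbb R^d)^{j-1}$, for $m$ in a $W_\ell$-neighbourhood of $\mu$, then $U$ admits a $j$-th order linear functional derivative at $\mu$ if for each $\mathbf y$ the map $m\mapsto\frac{\delta^{j-1}U}{\delta m^{j-1}}(m,\mathbf y)$ admits a linear functional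 derivative at $\mu$, denoted $y\mapsto\frac{\delta^jU}{\delta m^j}(\mu,\mathbf y,y)$. The derivatives are normalised by $\frac{\delta^jU}{\delta m^j}(m,y_1,\ldots,y_j)=0$ whenever $y_i=0$ for some $i$. Class $\mathcal S_{j,k}(\mathcal P_\ell(\mathbb R^d))$ ($j\in\mathbb N$, $j\ge 1$, $k,\ell\ge0$): the set of $U:\mathcal P_\ell(\mathbb R^d)\to\mathbb R$ such that for each $1\le i\le j$, $\frac{\delta^iU}{\delta m^i}$ exists on $\mathcal P_\ell(\mathbb R^d)\times(\mathbb R^d)^i$, is measurable in $(x_1,\ldots,x_i)$, and for some $C<\infty$, for all $x_1,\ldots,x_i\in\mathbb R^d$ and $\mu\in\mathcal P_\ell(\mathbb R^d)$, $\left|\frac{\delta^iU}{\delta m^i}(\mu,x_1,\ldots,x_i)\right|\le C\left(1+|x_1|^k+\cdots+|x_i|^k+1_{\{\ell>0\}}\left(\int|x|^\ell\mu(dx)\right)^{k/\ell}\right)$. *)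

theory Defs
  imports "HOL-Probability.Probability"
begin

text \<open>Real powers of nonnegative numbers with \<open>0\<^sup>0 = 1\<close>; in the library \<open>0 powr 0 = 0\<close>.\<close>

definition rpow :: "real \<Rightarrow> real \<Rightarrow> real" where
  "rpow t a = (if a = 0 then 1 else t powr a)"

definition P_space :: "real \<Rightarrow> 'a::euclidean_space measure set" where
  "P_space l = {m. prob_space m \<and> sets m = sets borel \<and> integrable m (\<lambda>x. rpow (norm x) l)}"

definition couplings :: "'a::euclidean_space measure \<Rightarrow> 'a measure \<Rightarrow> ('a \<times> 'a) measure set" where
  "couplings \<mu> \<nu> = {\<rho>. prob_space \<rho> \<and> sets \<rho> = sets (borel \<Otimes>\<^sub>M borel) \<and>
     distr \<rho> borel fst = \<mu> \<and> distr \<rho> borel snd = \<nu>}"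

definition W_dist :: "real \<Rightarrow> 'a::euclidean_space measure \<Rightarrow> 'a measure \<Rightarrow> real" where
  "W_dist l \<mu> \<nu> =
     (if l = 0 then INF \<rho>\<in>couplings \<mu> \<nu>. measure \<rho> {z. fst z \<noteq> snd z}
      else INF \<rho>\<in>couplings \<mu> \<nu>. (\<integral>z. norm (fst z - snd z) powr l \<partial>\<rho>) powr (1 / max l 1))"

definition discrete_measure :: "'a measure \<Rightarrow> bool" where
  "discrete_measure m \<longleftrightarrow> (\<exists>S. countable S \<and> (AE x in m. x \<in> S))"

text \<open>\<open>mixture \<epsilon> \<mu> \<nu>\<close> is \<open>\<mu> + \<epsilon> (\<nu> - \<mu>)\<close>, meaningful for \<open>0 \<le> \<epsilon> \<le> 1\<close>.\<close>

definition mixture :: "real \<Rightarrow> 'a::euclidean_space measure \<Rightarrow> 'a measure \<Rightarrow> 'a measure" where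
  "mixture \<epsilon> \<mu> \<nu> = measure_of UNIV (sets borel)
     (\<lambda>A. ennreal (1 - \<epsilon>) * emeasure \<mu> A + ennreal \<epsilon> * emeasure \<nu> A)"

definition empirical_measure :: "nat \<Rightarrow> (nat \<Rightarrow> 'a::euclidean_space) \<Rightarrow> 'a measure" where
  "empirical_measure N x = measure_of UNIV (sets borel)
     (\<lambda>A. ennreal (1 / real N) * (\<Sum>i=1..N. emeasure (return borel (x i)) A))"

lemma sigma_sets_borel: "sigma_sets UNIV (sets (borel :: 'a::topological_space measure)) = sets borel"
  using sets.sigma_sets_eq[of "borel :: 'a measure"] by simp

lemma emeasure_mixture:
  assumes "sets \<mu> = sets borel" "sets \<nu> = sets borel" "A \<in> sets borel"
  shows "emeasure (mixture \<epsilon> \<mu> \<nu>) A = ennreal (1 - \<epsilon>) * emeasure \<mu> A + ennreal \<epsilon> * emeasure \<nu> A"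
proof (rule emeasure_measure_of[OF mixture_def])
  show "countably_additive (sets (mixture \<epsilon> \<mu> \<nu>))
      (\<lambda>A. ennreal (1 - \<epsilon>) * emeasure \<mu> A + ennreal \<epsilon> * emeasure \<nu> A)"
    using assms
    by (auto simp: countably_additive_def mixture_def sigma_sets_borel suminf_add[symmetric]
        ennreal_suminf_cmult suminf_emeasure)
qed (use assms in \<open>auto simp: positive_def mixture_def\<close>)

lemma emeasure_empirical_measure:
  assumes "A \<in> sets borel"
  shows "emeasure (empirical_measure N x) A =
    ennreal (1 / real N) * (\<Sum>i=1..N. emeasure (return borel (x i)) A)"
proof (rule emeasure_measure_of[OF empirical_measure_def])
  show "countably_additive (sets (empirical_measure N x))
      (\<lambda>A. ennreal (1 / real N) * (\<Sum>i=1..N. emeasure (return borel (x i)) A))"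
    by (auto simp: countably_additive_def empirical_measure_def sigma_sets_borel ennreal_suminf_cmult
        suminf_sum suminf_emeasure simp del: emeasure_return)
qed (use assms in \<open>auto simp: positive_def empirical_measure_def\<close>)

text \<open>\<open>f\<close> is a (not necessarily normalised) linear functional derivative of \<open>U\<close> at \<open>\<mu>\<close>.\<close>

definition has_lfd ::
  "real \<Rightarrow> ('a::euclidean_space measure \<Rightarrow> real) \<Rightarrow> 'a measure \<Rightarrow> ('a \<Rightarrow> real) \<Rightarrow> bool" where
  "has_lfd l U \<mu> f \<longleftrightarrow>
     f \<in> borel_measurable borel \<and>
     bdd_above (range (\<lambda>y. \<bar>f y\<bar> / (1 + rpow (norm y) l))) \<and>
     (\<forall>\<nu>\<in>P_space l. ((\<lambda>\<epsilon>. U (mixture \<epsilon> \<mu> \<nu>)) has_real_derivative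
        ((\<integral>y. f y \<partial>\<nu>) - (\<integral>y. f y \<partial>\<mu>))) (at_right 0))"

lemma return_in_P_space: "return borel y \<in> P_space l"
proof -
  interpret prob_space "return borel y" by (rule prob_space_return) simp
  have "(\<lambda>x. rpow (norm x) l) \<in> borel_measurable borel"
    unfolding rpow_def by measurable
  moreover from this have "(\<integral>\<^sup>+x. ennreal (norm (rpow (norm x) l)) \<partial>return borel y) < \<infinity>"
    by (subst nn_integral_return) (auto intro!: measurable_compose[OF _ measurable_ennreal] borel_measurable_abs)
  ultimately show ?thesis
    by (auto simp: P_space_def integrable_iff_bounded prob_space_axioms)
qed

text \<open>A linear functional derivative is unique up to an additive constant, so at most one is
  normalised by \<open>f 0 = 0\<close>.\<close>

lemma has_lfd_unique:
  assumes "has_lfd l U \<mu> f" "has_lfd l U \<mu> g"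
  shows "f y - g y = f z - g z"
proof -
  have *: "f y - (\<integral>x. f x \<partial>\<mu>) = g y - (\<integral>x. g x \<partial>\<mu>)" for y
  proof -
    have "f \<in> borel_measurable borel" "g \<in> borel_measurable borel"
      using assms by (auto simp: has_lfd_def)
    then have i: "(\<integral>x. f x \<partial>return borel y) = f y" "(\<integral>x. g x \<partial>return borel y) = g y"
      by (auto intro!: integral_return)
    have "((\<lambda>\<epsilon>. U (mixture \<epsilon> \<mu> (return borel y))) has_real_derivative h y - (\<integral>x. h x \<partial>\<mu>)) (at_right 0)"
      if "h = f \<or> h = g" for h
      using that assms return_in_P_space[of y l] i by (auto simp: has_lfd_def dest!: bspec)
    from this[of f] this[of g] show ?thesis
      unfolding has_field_derivative_iff
      using tendsto_unique[OF trivial_limit_at_right_real] i by blast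
  qed
  show ?thesis using *[of y] *[of z] by simp
qed


definition lfd ::
  "real \<Rightarrow> ('a::euclidean_space measure \<Rightarrow> real) \<Rightarrow> 'a measure \<Rightarrow> 'a \<Rightarrow> real" where
  "lfd l U \<mu> = (THE f. has_lfd l U \<mu> f \<and> f 0 = 0)"

text \<open>\<open>lfd_n l U j \<mu> x\<close> is the \<open>j\<close>-th derivative of \<open>U\<close> at \<open>\<mu>\<close> and
  \<open>(x 0, \<dots>, x (j - 1))\<close>; the other values of \<open>x\<close> are not used. It vanishes as soon as one
  of these arguments is \<open>0\<close>: if \<open>x p = 0\<close> then the \<open>(p + 1)\<close>-th derivative is \<open>0\<close> for every
  measure, and so are the normalised derivatives of that zero map.\<close>

primrec lfd_n ::
  "real \<Rightarrow> ('a::euclidean_space measure \<Rightarrow> real) \<Rightarrow> nat \<Rightarrow> 'a measure \<Rightarrow> (nat \<Rightarrow> 'a) \<Rightarrow> real" where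
  "lfd_n l U 0 = (\<lambda>\<mu> x. U \<mu>)"
| "lfd_n l U (Suc j) = (\<lambda>\<mu> x. lfd l (\<lambda>m. lfd_n l U j m x) \<mu> (x j))"

primrec admits_lfd_n ::
  "real \<Rightarrow> ('a::euclidean_space measure \<Rightarrow> real) \<Rightarrow> nat \<Rightarrow> 'a measure \<Rightarrow> bool" where
  "admits_lfd_n l U 0 = (\<lambda>\<mu>. True)"
| "admits_lfd_n l U (Suc j) = (\<lambda>\<mu>.
     (\<exists>r>0. \<forall>m\<in>P_space l. W_dist l m \<mu> < r \<longrightarrow> admits_lfd_n l U j m) \<and>
     (\<forall>x. \<exists>f. has_lfd l (\<lambda>m. lfd_n l U j m x) \<mu> f))"

definition S_class :: "nat \<Rightarrow> real \<Rightarrow> real \<Rightarrow> ('a::euclidean_space measure \<Rightarrow> real) set" where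
  "S_class j k l = {U. \<forall>i\<in>{1..j}.
     (\<forall>\<mu>\<in>P_space l. admits_lfd_n l U i \<mu> \<and>
        lfd_n l U i \<mu> \<in> borel_measurable (Pi\<^sub>M {..<i} (\<lambda>_. borel))) \<and>
     (\<exists>C. \<forall>\<mu>\<in>P_space l. \<forall>x. \<bar>lfd_n l U i \<mu> x\<bar> \<le>
        C * (1 + (\<Sum>p<i. rpow (norm (x p)) k) +
          (if l > 0 then rpow (\<integral>z. rpow (norm z) l \<partial>\<mu>) (k / l) else 0)))}"

text \<open>The normal law with mean \<open>a\<close> and variance \<open>v \<ge> 0\<close>, which is a Dirac mass if \<open>v = 0\<close>.\<close>

definition normal_law :: "real \<Rightarrow> real \<Rightarrow> real measure" where
  "normal_law a v =
     (if v = 0 then return borel a else density lborel (normal_density a (sqrt v)))"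

text \<open>A functional of measures need not be measurable, but if the law of the samples is discrete,
  a functional of their empirical measure agrees almost surely with a random variable, i.e. it is
  measurable with respect to the completion of the probability space.\<close>

definition converges_in_distribution ::
  "'w measure \<Rightarrow> (nat \<Rightarrow> 'w \<Rightarrow> real) \<Rightarrow> real measure \<Rightarrow> bool" where
  "converges_in_distribution M X L \<longleftrightarrow>
     (\<forall>N\<ge>1. X N \<in> borel_measurable (completion M)) \<and>
     weak_conv_m (\<lambda>N. distr (completion M) borel (X N)) L"

end

theory Submission
  imports Defs
begin

text \<open>Replace the sample points one at a time: let \<open>\<kappa>\<^sub>i\<close> be the measure
  \<open>(\<delta>\<^sub>\<zeta>\<^sub>1 + \<dots> + \<delta>\<^sub>\<zeta>\<^sub>i + (N - i) m0) / N\<close> and telescope \<open>U (\<kappa>\<^sub>N) - U (\<kappa>\<^sub>0)\<close>. By the mean value theorem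
  along mixtures, the \<open>i\<close>-th increment is \<open>1/N\<close> times the centred value at \<open>\<zeta>\<^sub>i\<close> of the derivative at
  \<open>\<kappa>\<^sub>i\<^sub>-\<^sub>1\<close>, up to an error of order \<open>1/N\<^sup>2\<close> in mean controlled by the second derivative. Replacing
  the derivative at \<open>\<kappa>\<^sub>i\<^sub>-\<^sub>1\<close> by that at \<open>m0\<close> changes the sum by a martingale whose normalised variance is
  bounded by the mean of the total variation of \<open>\<kappa>\<^sub>i\<^sub>-\<^sub>1 - m0\<close> weighted by \<open>1 + |y|\<^sup>l\<close>. As \<open>m0\<close> is
  discrete, this tends to \<open>0\<close> by dominated convergence, atom by atom. What remains is a normalised sum of
  i.i.d. variables, and an error that vanishes in mean does not affect the limit law.\<close>

section \<open>Differentiation along mixtures\<close>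

text \<open>\<open>U\<close> and its derivatives need not be measurable in the measure argument, so
  functions of the samples cannot simply be integrated. Discreteness removes this obstacle too: with
  \<open>m0\<close> as a \<open>pmf\<close> and finite samples under \<open>Pi_pmf\<close> every
  function is measurable, and the results are carried over to the completion of \<open>M\<close> at
  the end. The derivative of step \<open>i\<close> is taken at the measure reached before that step
  because it does not involve the new sample; this makes the corrections orthogonal. Orthogonality
  must supply the whole factor \<open>sqrt N\<close>, since the weighted distance to
  \<open>m0\<close> need not decay at any rate. Nor may that distance be squared, as its second
  moment can be infinite when only \<open>w\<close>, the \<open>l\<close>-th power of the norm, is
  integrable. The squared increment of the derivative is therefore bounded by the first power of the
  distance. The order \<open>l / 2\<close> in the first variable of the second derivative makes this
  possible: after squaring it is of order \<open>l\<close>, which \<open>m0\<close>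
  integrates.\<close>

lemma rpow_nonneg [simp]: "0 \<le> rpow t a"
  by (simp add: rpow_def)

lemma one_plus_rpow_pos [simp]: "0 < 1 + rpow t a"
  by (rule add_pos_nonneg) auto

lemma borel_measurable_rpow [measurable]: "(\<lambda>x. rpow x a) \<in> borel_measurable borel"
  unfolding rpow_def by measurable

lemma rpow_half: "0 \<le> t \<Longrightarrow> rpow t (a / 2) = sqrt (rpow t a)"
  by (simp add: rpow_def powr_half_sqrt[symmetric] powr_powr)

lemma sqrt_le_1_plus: "0 \<le> t \<Longrightarrow> sqrt t \<le> 1 + t"
  by (rule real_le_lsqrt) (auto simp: power2_eq_square algebra_simps)

section \<open>Mixtures as measures\<close>

lemma sets_mixture [simp, measurable_cong]: "sets (mixture \<epsilon> \<mu> \<nu>) = sets borel"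
  by (simp add: mixture_def sigma_sets_borel)

lemma space_mixture [simp]: "space (mixture \<epsilon> \<mu> \<nu>) = UNIV"
  by (simp add: mixture_def)

text \<open>\<open>mixture\<close> is known only through its values on sets, so the identity is
  built up from indicators. In the limit step both sequences of integrals increase, which lets the
  supremum split over the sum.\<close>

lemma nn_integral_mixture:
  assumes [measurable_cong]: "sets \<mu> = sets borel" "sets \<nu> = sets borel"
    and "f \<in> borel_measurable borel"
  shows "(\<integral>\<^sup>+x. f x \<partial>mixture \<epsilon> \<mu> \<nu>) =
    ennreal (1 - \<epsilon>) * (\<integral>\<^sup>+x. f x \<partial>\<mu>) + ennreal \<epsilon> * (\<integral>\<^sup>+x. f x \<partial>\<nu>)"
  using assms(3)
proof (induction rule: borel_measurable_induct)
  case (cong f g)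
  then have "f = g" by auto
  with cong show ?case by simp
next
  case (set A)
  then show ?case using assms(1,2)
    by (simp add: emeasure_mixture)
next
  case (mult u c)
  then show ?case
    by (simp add: nn_integral_cmult distrib_left ac_simps)
next
  case (add u v)
  then show ?case
    by (simp add: nn_integral_add distrib_left ac_simps)
next
  case (seq F)
  have inc: "incseq (\<lambda>i. \<integral>\<^sup>+x. F i x \<partial>m)" for m
    using seq by (auto simp: incseq_def le_fun_def intro!: nn_integral_mono)
  have [measurable]: "\<And>i. F i \<in> borel_measurable borel" by fact
  have "(\<integral>\<^sup>+x. (SUP i. F i) x \<partial>m) = (SUP i. \<integral>\<^sup>+x. F i x \<partial>m)" if "sets m = sets borel" for m
    using seq that by (auto simp: nn_integral_monotone_convergence_SUP image_comp cong: measurable_cong_sets)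
  then show ?case
    using assms(1,2) inc seq.IH
    by (simp add: ennreal_SUP_add[symmetric] SUP_mult_left_ennreal incseq_def mult_left_mono)
qed

text \<open>\<open>mixture\<close> passes its weights through \<open>ennreal\<close>, which
  truncates negative numbers to 0; the bounds on \<open>\<epsilon>\<close> keep both weights intact.
  The real integral is the difference of the integrals of the positive and negative parts.\<close>

lemma integral_mixture:
  fixes f :: "'a::euclidean_space \<Rightarrow> real"
  assumes [measurable_cong]: "sets \<mu> = sets borel" "sets \<nu> = sets borel"
    and "0 \<le> \<epsilon>" "\<epsilon> \<le> 1" and f: "integrable \<mu> f" "integrable \<nu> f"
  shows "integrable (mixture \<epsilon> \<mu> \<nu>) f"
    and "(\<integral>x. f x \<partial>mixture \<epsilon> \<mu> \<nu>) = (1 - \<epsilon>) * (\<integral>x. f x \<partial>\<mu>) + \<epsilon> * (\<integral>x. f x \<partial>\<nu>)"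
proof -
  have [measurable]: "f \<in> borel_measurable borel"
    using borel_measurable_integrable[OF f(1)] by simp
  show i: "integrable (mixture \<epsilon> \<mu> \<nu>) f"
    using f assms(1,2) by (auto simp: integrable_iff_bounded nn_integral_mixture ennreal_mult_less_top)
  have fin: "(\<integral>\<^sup>+x. ennreal (g x) \<partial>m) = ennreal (enn2real (\<integral>\<^sup>+x. ennreal (g x) \<partial>m))"
    if "integrable m g" for g m
    using that by (simp add: real_integrable_def top.not_eq_extremum)
  show "(\<integral>x. f x \<partial>mixture \<epsilon> \<mu> \<nu>) = (1 - \<epsilon>) * (\<integral>x. f x \<partial>\<mu>) + \<epsilon> * (\<integral>x. f x \<partial>\<nu>)"
  proof -
    have *: "enn2real (\<integral>\<^sup>+x. ennreal (g x) \<partial>mixture \<epsilon> \<mu> \<nu>) =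
      (1 - \<epsilon>) * enn2real (\<integral>\<^sup>+x. ennreal (g x) \<partial>\<mu>) + \<epsilon> * enn2real (\<integral>\<^sup>+x. ennreal (g x) \<partial>\<nu>)"
      if "integrable \<mu> g" "integrable \<nu> g" and [measurable]: "g \<in> borel_measurable borel" for g
      using assms(1-4) by (simp add: nn_integral_mixture)
         (subst fin[OF that(1)], subst fin[OF that(2)],
            simp add: ennreal_mult[symmetric] ennreal_plus[symmetric] del: ennreal_plus)
    show ?thesis
      using i f by (simp add: real_lebesgue_integral_def *[of f] *[of "\<lambda>x. - f x"] algebra_simps)
  qed
qed

lemma mixture_0 [simp]: "sets \<mu> = sets borel \<Longrightarrow> sets \<nu> = sets borel \<Longrightarrow> mixture 0 \<mu> \<nu> = \<mu>"
  by (rule measure_eqI) (auto simp: emeasure_mixture)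

lemma mixture_1 [simp]: "sets \<mu> = sets borel \<Longrightarrow> sets \<nu> = sets borel \<Longrightarrow> mixture 1 \<mu> \<nu> = \<nu>"
  by (rule measure_eqI) (auto simp: emeasure_mixture)

lemma mixture_commute:
  assumes "sets \<mu> = sets borel" "sets \<nu> = sets borel"
  shows "mixture (1 - \<epsilon>) \<mu> \<nu> = mixture \<epsilon> \<nu> \<mu>"
  using assms by (intro measure_eqI) (auto simp: emeasure_mixture add.commute)

text \<open>Moving a fraction \<open>\<epsilon>\<close> of the remaining way towards
  \<open>\<nu>\<close> stays on the segment. A derivative at \<open>mixture s \<mu> \<nu>\<close>,
  which concerns paths starting there, thus speaks about the path from \<open>\<mu>\<close> to
  \<open>\<nu>\<close>.\<close>

lemma mixture_mixture:
  assumes "sets \<mu> = sets borel" "sets \<nu> = sets borel" "0 \<le> s" "s \<le> 1" "0 \<le> \<epsilon>" "\<epsilon> \<le> 1"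
  shows "mixture \<epsilon> (mixture s \<mu> \<nu>) \<nu> = mixture (s + \<epsilon> * (1 - s)) \<mu> \<nu>"
proof (rule measure_eqI)
  fix A assume "A \<in> sets (mixture \<epsilon> (mixture s \<mu> \<nu>) \<nu>)"
  moreover have "ennreal (1 - (s + \<epsilon> * (1 - s))) = ennreal (1 - \<epsilon>) * ennreal (1 - s)"
    using assms by (simp add: ennreal_mult[symmetric] algebra_simps)
  moreover have "ennreal (s + \<epsilon> * (1 - s)) = ennreal (1 - \<epsilon>) * ennreal s + ennreal \<epsilon>"
  proof -
    have "s + \<epsilon> * (1 - s) = (1 - \<epsilon>) * s + \<epsilon>" by (simp add: algebra_simps)
    then show ?thesis using assms by (simp add: ennreal_mult)
  qed
  ultimately show "emeasure (mixture \<epsilon> (mixture s \<mu> \<nu>) \<nu>) A = emeasure (mixture (s + \<epsilon> * (1 - s)) \<mu> \<nu>) A"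
    using assms by (simp add: emeasure_mixture distrib_left distrib_right ac_simps)
qed simp

lemma P_space_D:
  assumes "\<mu> \<in> P_space l"
  shows "prob_space \<mu>" "sets \<mu> = sets borel" "space \<mu> = UNIV" "integrable \<mu> (\<lambda>x. rpow (norm x) l)"
  using assms sets_eq_imp_space_eq[of \<mu> borel] by (auto simp: P_space_def)

lemma mixture_in_P_space:
  assumes "\<mu> \<in> P_space l" "\<nu> \<in> P_space l" "0 \<le> \<epsilon>" "\<epsilon> \<le> 1"
  shows "mixture \<epsilon> \<mu> \<nu> \<in> P_space l"
proof -
  note [simp] = P_space_D[OF assms(1)] P_space_D[OF assms(2)]
  have "emeasure \<mu> UNIV = 1" "emeasure \<nu> UNIV = 1"
    using prob_space.emeasure_space_1[of \<mu>] prob_space.emeasure_space_1[of \<nu>] by auto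
  then have "prob_space (mixture \<epsilon> \<mu> \<nu>)"
    using assms by (intro prob_spaceI) (simp add: emeasure_mixture ennreal_plus[symmetric] del: ennreal_plus)
  then show ?thesis
    using assms by (auto simp: P_space_def intro!: integral_mixture)
qed

lemma integrable_P_space:
  fixes f :: "'a::euclidean_space \<Rightarrow> real"
  assumes "\<mu> \<in> P_space l" and f: "f \<in> borel_measurable borel"
    and "\<And>y. \<bar>f y\<bar> \<le> K * (1 + rpow (norm y) l)"
  shows "integrable \<mu> f"
proof (rule Bochner_Integration.integrable_bound[of _ "\<lambda>y. K * (1 + rpow (norm y) l)"])
  interpret prob_space \<mu> using P_space_D[OF assms(1)] by simp
  show "integrable \<mu> (\<lambda>y. K * (1 + rpow (norm y) l))"
    using P_space_D[OF assms(1)] by (intro integrable_mult_right) auto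
  show "f \<in> borel_measurable \<mu>" using f P_space_D[OF assms(1)] by (simp cong: measurable_cong_sets)
  show "AE y in \<mu>. norm (f y) \<le> norm (K * (1 + rpow (norm y) l))"
    using order_trans[OF assms(3) abs_ge_self] by auto
qed

section \<open>Integrability and normalisation of linear functional derivatives\<close>

lemma has_lfd_bound:
  assumes "has_lfd l U \<mu> f"
  obtains K where "\<And>y. \<bar>f y\<bar> \<le> K * (1 + rpow (norm y) l)"
proof -
  obtain K where "\<bar>f y\<bar> / (1 + rpow (norm y) l) \<le> K" for y
    using assms by (auto simp: has_lfd_def bdd_above_def)
  then show thesis
    by (intro that[of K]) (simp add: pos_divide_le_eq)
qed

lemma has_lfd_integrable:
  assumes "has_lfd l U \<mu> f" "\<nu> \<in> P_space l"
  shows "integrable \<nu> f"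
  using has_lfd_bound[OF assms(1)] integrable_P_space[OF assms(2)] assms(1) by (metis has_lfd_def)

text \<open>A constant has the same integral against every probability measure, so it drops out of
  the difference that defines the derivative.\<close>

lemma has_lfd_diff_const:
  assumes f: "has_lfd l U \<mu> f" and \<mu>: "\<mu> \<in> P_space l"
  shows "has_lfd l U \<mu> (\<lambda>y. f y - c)"
proof -
  obtain K where K: "\<And>y. \<bar>f y\<bar> \<le> K * (1 + rpow (norm y) l)"
    using has_lfd_bound[OF f] by blast
  have "\<bar>f y - c\<bar> / (1 + rpow (norm y) l) \<le> K + \<bar>c\<bar>" for y
  proof -
    have "\<bar>f y - c\<bar> \<le> K * (1 + rpow (norm y) l) + \<bar>c\<bar>"
      using K[of y] by linarith
    also have "\<dots> \<le> (K + \<bar>c\<bar>) * (1 + rpow (norm y) l)"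
      by (simp add: algebra_simps)
    finally show ?thesis by (simp add: pos_divide_le_eq)
  qed
  moreover have "(\<integral>y. f y - c \<partial>\<nu>) = (\<integral>y. f y \<partial>\<nu>) - c" if "\<nu> \<in> P_space l" for \<nu>
  proof -
    interpret prob_space \<nu> using P_space_D[OF that] by simp
    show ?thesis using has_lfd_integrable[OF f that] by (simp add: prob_space)
  qed
  ultimately show ?thesis using f \<mu> by (auto simp: has_lfd_def bdd_above_def)
qed

text \<open>\<open>lfd\<close> is a definite description: shifting by \<open>f 0\<close> gives
  existence, and uniqueness up to constants gives uniqueness of the normalised choice.\<close>

lemma has_lfd_lfd:
  assumes "has_lfd l U \<mu> f" "\<mu> \<in> P_space l"
  shows "has_lfd l U \<mu> (lfd l U \<mu>)"
proof -
  have "\<exists>!g. has_lfd l U \<mu> g \<and> g 0 = 0"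
  proof (rule ex_ex1I)
    show "\<exists>g. has_lfd l U \<mu> g \<and> g 0 = 0"
      using has_lfd_diff_const[OF assms, of "f 0"] by auto
    show "g = h" if "has_lfd l U \<mu> g \<and> g 0 = 0" "has_lfd l U \<mu> h \<and> h 0 = 0" for g h
      using has_lfd_unique[of l U \<mu> g h _ 0] that by (auto simp: fun_eq_iff)
  qed
  from theI'[OF this] show ?thesis by (simp add: lfd_def)
qed

text \<open>The right derivative of \<open>s \<mapsto> U (mixture s \<mu> \<nu>)\<close> comes from moving towards \<open>\<nu>\<close>; the left one is
  the right derivative of the reversed path, which moves towards \<open>\<mu>\<close>.\<close>

lemma mixture_right_derivative:
  assumes D: "has_lfd l U (mixture s \<mu> \<nu>) f" and P: "\<mu> \<in> P_space l" "\<nu> \<in> P_space l"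
    and s: "0 \<le> s" "s < 1"
  shows "((\<lambda>t. U (mixture t \<mu> \<nu>)) has_real_derivative (\<integral>y. f y \<partial>\<nu>) - (\<integral>y. f y \<partial>\<mu>)) (at_right s)"
proof -
  let ?d = "(\<integral>y. f y \<partial>\<nu>) - (\<integral>y. f y \<partial>\<mu>)"
  note S = P_space_D(2)[OF P(1)] P_space_D(2)[OF P(2)]
  have i: "integrable \<mu> f" "integrable \<nu> f" using has_lfd_integrable[OF D] P by auto
  have "((\<lambda>\<epsilon>. U (mixture \<epsilon> (mixture s \<mu> \<nu>) \<nu>)) has_real_derivative
      (\<integral>y. f y \<partial>\<nu>) - (\<integral>y. f y \<partial>mixture s \<mu> \<nu>)) (at_right 0)"
    using D P by (auto simp: has_lfd_def)
  \<comment> \<open>Only the fraction \<open>1 - s\<close> of the segment remains, which scales the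
    derivative; the change of parameter below divides it out.\<close>
  also have "(\<integral>y. f y \<partial>\<nu>) - (\<integral>y. f y \<partial>mixture s \<mu> \<nu>) = (1 - s) * ?d"
    using s i S by (simp add: integral_mixture algebra_simps)
  finally have 1: "((\<lambda>\<epsilon>. (U (mixture \<epsilon> (mixture s \<mu> \<nu>) \<nu>) - U (mixture s \<mu> \<nu>)) / \<epsilon>) \<longlongrightarrow> (1 - s) * ?d) (at_right 0)"
    using S by (simp add: has_field_derivative_iff)
  have "((\<lambda>\<epsilon>. (U (mixture (s + \<epsilon> * (1 - s)) \<mu> \<nu>) - U (mixture s \<mu> \<nu>)) / \<epsilon>) \<longlongrightarrow> (1 - s) * ?d) (at_right 0)"
    by (rule Lim_transform_eventually[OF 1])
       (use s S in \<open>auto simp: mixture_mixture eventually_at_right[of 0 1] intro!: exI[of _ 1]\<close>)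
  moreover have "filterlim (\<lambda>t. (t - s) / (1 - s)) (at_right 0) (at_right s)"
    unfolding filterlim_at
    using s by (auto intro!: tendsto_eq_intros simp: eventually_at_right[of s "s+1"] intro!: exI[of _ "s+1"])
  ultimately have 2: "((\<lambda>t. (U (mixture (s + ((t - s) / (1 - s)) * (1 - s)) \<mu> \<nu>) - U (mixture s \<mu> \<nu>)) /
      ((t - s) / (1 - s))) \<longlongrightarrow> (1 - s) * ?d) (at_right s)"
    by (rule filterlim_compose)
  from tendsto_divide[OF 2 tendsto_const[of "1 - s"]]
  have "((\<lambda>t. (U (mixture t \<mu> \<nu>) - U (mixture s \<mu> \<nu>)) / (t - s)) \<longlongrightarrow> ?d) (at_right s)"
    using s by simp
  then show ?thesis by (simp add: has_field_derivative_iff)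
qed

lemma mixture_derivative:
  assumes D: "has_lfd l U (mixture s \<mu> \<nu>) f" and P: "\<mu> \<in> P_space l" "\<nu> \<in> P_space l"
    and s: "0 \<le> s" "s \<le> 1"
  shows "((\<lambda>t. U (mixture t \<mu> \<nu>)) has_real_derivative (\<integral>y. f y \<partial>\<nu>) - (\<integral>y. f y \<partial>\<mu>)) (at s within {0..1})"
proof -
  let ?d = "(\<integral>y. f y \<partial>\<nu>) - (\<integral>y. f y \<partial>\<mu>)"
  let ?q = "\<lambda>t. (U (mixture t \<mu> \<nu>) - U (mixture s \<mu> \<nu>)) / (t - s)"
  note S = P_space_D(2)[OF P(1)] P_space_D(2)[OF P(2)]
  have r: "(?q \<longlongrightarrow> ?d) (at s within {s<..1})"
  proof (cases "s < 1")
    case True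
    from mixture_right_derivative[OF D P s(1) this] show ?thesis
      unfolding has_field_derivative_iff by (rule tendsto_within_subset) auto
  qed (auto simp: not_less)
  have l: "(?q \<longlongrightarrow> ?d) (at s within {0..<s})"
  proof (cases "0 < s")
    case True
    have "mixture (1 - s) \<nu> \<mu> = mixture s \<mu> \<nu>" using mixture_commute[OF S(2,1)] by simp
    with D have D': "has_lfd l U (mixture (1 - s) \<nu> \<mu>) f" by simp
    have "filterlim (\<lambda>t. 1 - t) (at_right (1 - s)) (at s within {0..<s})"
      unfolding filterlim_at by (auto intro!: tendsto_eq_intros simp: eventually_at_filter)
    from filterlim_compose[OF mixture_right_derivative[OF D' P(2,1), unfolded has_field_derivative_iff] this]
    have "((\<lambda>t. (U (mixture t \<mu> \<nu>) - U (mixture s \<mu> \<nu>)) / (s - t)) \<longlongrightarrow> - ?d) (at s within {0..<s})"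
      using True s S by (simp add: mixture_commute)
    from tendsto_minus[OF this] show ?thesis
      by (simp add: minus_divide_right)
  next
    case False
    then have "{0..<s} = {}" by auto
    then show ?thesis by simp
  qed
  \<comment> \<open>At an endpoint one of the two sets is empty and its limit is vacuous, so the
    union covers all \<open>s\<close> in the closed interval.\<close>
  have "(?q \<longlongrightarrow> ?d) (at s within {0..<s} \<union> {s<..1})"
    using l r by (simp add: Lim_within_Un)
  also have "at s within {0..<s} \<union> {s<..1} = at s within {0..1}"
    unfolding at_within_def using s by (intro arg_cong2[where f=inf] refl arg_cong[where f=principal]) auto
  finally show ?thesis by (simp add: has_field_derivative_iff)
qed

text \<open>The classical mean value theorem along the segment. \<open>D\<close> is any choice of
  derivatives, so the lemma serves \<open>U\<close> itself and, with \<open>x\<close> fixed, the map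
  from \<open>m\<close> to \<open>D m x\<close>.\<close>

lemma lfd_mean_value:
  assumes D: "\<And>m. m \<in> P_space l \<Longrightarrow> has_lfd l U m (D m)"
    and P: "\<mu> \<in> P_space l" "\<nu> \<in> P_space l"
  obtains s where "0 < s" "s < 1"
    "U \<nu> - U \<mu> = (\<integral>y. D (mixture s \<mu> \<nu>) y \<partial>\<nu>) - (\<integral>y. D (mixture s \<mu> \<nu>) y \<partial>\<mu>)"
proof -
  let ?d = "\<lambda>s. (\<integral>y. D (mixture s \<mu> \<nu>) y \<partial>\<nu>) - (\<integral>y. D (mixture s \<mu> \<nu>) y \<partial>\<mu>)"
  have "((\<lambda>t. U (mixture t \<mu> \<nu>)) has_derivative (\<lambda>h. h * ?d s)) (at s within {0..1})" if "0 \<le> s" "s \<le> 1" for s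
    using mixture_derivative[OF D[OF mixture_in_P_space[OF P that]] P that]
    by (simp add: has_field_derivative_def mult.commute[of _ "?d s"] cong: if_cong)
  from mvt_simple[of 0 1 _ "\<lambda>s h. h * ?d s", OF _ this]
  obtain s where "0 < s" "s < 1" "U (mixture 1 \<mu> \<nu>) - U (mixture 0 \<mu> \<nu>) = (1 - 0) * ?d s"
    by auto
  then show thesis
    using P_space_D(2)[OF P(1)] P_space_D(2)[OF P(2)] by (intro that) auto
qed

section \<open>Expectations over finite samples and partial empirical measures\<close>

lemma expectation_measure_pmf_conv_count_space:
  fixes f :: "'a \<Rightarrow> real"
  shows "measure_pmf.expectation q f = (\<integral>y. pmf q y * f y \<partial>count_space UNIV)"
    and "integrable (measure_pmf q) f \<longleftrightarrow> integrable (count_space UNIV) (\<lambda>y. pmf q y * f y)"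
  by (simp_all add: measure_pmf_eq_density integral_density integrable_density)

text \<open>The mass function of the mixture is the average of the mass functions, and an
  expectation written over the counting measure is linear in the mass function.\<close>

lemma expectation_bind_pmf_of_set:
  fixes h :: "'b \<Rightarrow> real"
  assumes A: "finite A" "A \<noteq> {}" and h: "\<And>a. a \<in> A \<Longrightarrow> integrable (measure_pmf (f a)) h"
  shows "integrable (measure_pmf (bind_pmf (pmf_of_set A) f)) h"
    and "measure_pmf.expectation (bind_pmf (pmf_of_set A) f) h =
      (\<Sum>a\<in>A. measure_pmf.expectation (f a) h) / card A"
proof -
  have *: "pmf (bind_pmf (pmf_of_set A) f) y * h y = (\<Sum>a\<in>A. pmf (f a) y * h y) / card A" for y
    using A by (simp add: pmf_bind integral_pmf_of_set sum_distrib_right)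
  show "integrable (measure_pmf (bind_pmf (pmf_of_set A) f)) h"
    using h unfolding expectation_measure_pmf_conv_count_space(2) * by auto
  show "measure_pmf.expectation (bind_pmf (pmf_of_set A) f) h =
      (\<Sum>a\<in>A. measure_pmf.expectation (f a) h) / card A"
    using h unfolding expectation_measure_pmf_conv_count_space * by (simp add: integral_sum)
qed

text \<open>Where \<open>pmf p\<close> vanishes so does \<open>pmf q\<close>, by the inclusion of
  supports, and division by zero gives 0, so no mass is lost.\<close>

lemma measure_pmf_eq_density_ratio:
  assumes "set_pmf q \<subseteq> set_pmf p"
  shows "measure_pmf q = density (measure_pmf p) (\<lambda>y. pmf q y / pmf p y)"
proof (rule measure_eqI)
  fix A assume "A \<in> sets (measure_pmf q)"
  have *: "ennreal (pmf p y) * (ennreal (pmf q y / pmf p y) * i) = ennreal (pmf q y) * i" for y i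
  proof (cases "pmf p y = 0")
    case True
    then have "pmf q y = 0" using assms by (auto simp: set_pmf_eq)
    with True show ?thesis by simp
  qed (simp add: mult.assoc[symmetric] ennreal_mult[symmetric])
  have "emeasure (measure_pmf q) A = (\<integral>\<^sup>+y. indicator A y \<partial>measure_pmf q)"
    by simp
  also have "\<dots> = (\<integral>\<^sup>+y. ennreal (pmf q y / pmf p y) * indicator A y \<partial>measure_pmf p)"
    unfolding nn_integral_measure_pmf * ..
  also have "\<dots> = emeasure (density (measure_pmf p) (\<lambda>y. pmf q y / pmf p y)) A"
    by (simp add: emeasure_density)
  finally show "emeasure (measure_pmf q) A = emeasure (density (measure_pmf p) (\<lambda>y. pmf q y / pmf p y)) A" .
qed simp

lemma expectation_density_ratio:
  fixes h :: "'a \<Rightarrow> real"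
  assumes "set_pmf q \<subseteq> set_pmf p"
  shows "integrable (measure_pmf q) h \<longleftrightarrow> integrable (measure_pmf p) (\<lambda>y. pmf q y / pmf p y * h y)"
    and "measure_pmf.expectation q h = measure_pmf.expectation p (\<lambda>y. pmf q y / pmf p y * h y)"
  by (simp_all add: measure_pmf_eq_density_ratio[OF assms] integral_density integrable_density)

text \<open>Tonelli for two discrete laws, obtained by swapping the components of
  \<open>pair_pmf\<close>; it applies to arbitrary \<open>f\<close>, in particular to expressions in
  \<open>U\<close>.\<close>

lemma nn_integral_pmf_commute:
  "(\<integral>\<^sup>+x. (\<integral>\<^sup>+y. f x y \<partial>measure_pmf q) \<partial>measure_pmf p) =
   (\<integral>\<^sup>+y. (\<integral>\<^sup>+x. f x y \<partial>measure_pmf p) \<partial>measure_pmf q)"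
  using nn_integral_pair_pmf'[of p q "\<lambda>(x, y). f x y"] nn_integral_pair_pmf'[of q p "\<lambda>(y, x). f x y"]
  by (subst (asm) pair_commute_pmf) (simp add: case_prod_beta)

text \<open>The new coordinate is integrated innermost with the others frozen; in the martingale
  argument this is conditioning on the earlier samples.\<close>

lemma nn_integral_Pi_pmf_insert:
  assumes "finite A" "a \<notin> A"
  shows "(\<integral>\<^sup>+x. F x \<partial>Pi_pmf (insert a A) d p) = (\<integral>\<^sup>+x. (\<integral>\<^sup>+y. F (x(a := y)) \<partial>p a) \<partial>Pi_pmf A d p)"
  using assms
  by (simp add: Pi_pmf_insert nn_integral_pair_pmf' nn_integral_pmf_commute[of _ "p a"])

text \<open>Jensen's inequality, in the form that the variance of the absolute value is
  nonnegative.\<close>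

lemma (in prob_space) nn_integral_abs_le_sqrt:
  fixes X :: "'a \<Rightarrow> real"
  assumes [measurable]: "X \<in> borel_measurable M" and le: "(\<integral>\<^sup>+x. ennreal ((X x)\<^sup>2) \<partial>M) \<le> ennreal c"
  shows "(\<integral>\<^sup>+x. ennreal \<bar>X x\<bar> \<partial>M) \<le> ennreal (sqrt c)"
proof -
  have i2: "integrable M (\<lambda>x. (X x)\<^sup>2)"
    using order.strict_trans1[OF le] by (intro integrableI_bounded) auto
  then have i: "integrable M X"
    by (rule square_integrable_imp_integrable[rotated]) auto
  have "0 \<le> variance (\<lambda>x. \<bar>X x\<bar>)" by (rule variance_positive)
  also have "\<dots> = expectation (\<lambda>x. (X x)\<^sup>2) - (expectation (\<lambda>x. \<bar>X x\<bar>))\<^sup>2"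
    using i i2 by (subst variance_eq) auto
  finally have "(expectation (\<lambda>x. \<bar>X x\<bar>))\<^sup>2 \<le> expectation (\<lambda>x. (X x)\<^sup>2)" by simp
  moreover have "expectation (\<lambda>x. (X x)\<^sup>2) \<le> max 0 c"
    using le i2 by (auto simp: nn_integral_eq_integral ennreal_le_iff2)
  \<comment> \<open>For negative \<open>c\<close> the number \<open>ennreal c\<close> is 0, so the
    second moment vanishes; \<open>sqrt c\<close> is then negative and \<open>ennreal\<close> sends
    it to 0 as well.\<close>
  moreover have "0 \<le> c \<or> expectation (\<lambda>x. (X x)\<^sup>2) = 0"
    using le i2 by (cases "0 \<le> c") (auto simp: nn_integral_eq_integral ennreal_le_iff2 ennreal_neg intro!: antisym)
  ultimately have "expectation (\<lambda>x. \<bar>X x\<bar>) \<le> sqrt c \<or> expectation (\<lambda>x. \<bar>X x\<bar>) \<le> 0"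
    by (auto simp: real_le_rsqrt)
  then show ?thesis
    using i by (auto simp: nn_integral_eq_integral ennreal_leI ennreal_neg)
qed

lemma nn_integral_square_divide_sqrt:
  "(\<integral>\<^sup>+x. ennreal ((f x / sqrt (real N))\<^sup>2) \<partial>measure_pmf p) =
    ennreal (1 / real N) * (\<integral>\<^sup>+x. ennreal ((f x)\<^sup>2) \<partial>measure_pmf p)"
proof -
  have "ennreal ((f x / sqrt (real N))\<^sup>2) = ennreal (1 / real N) * ennreal ((f x)\<^sup>2)" for x
    by (subst ennreal_mult[symmetric]) (auto simp: power_divide)
  then show ?thesis by (simp add: nn_integral_cmult)
qed

text \<open>Orthogonality of martingale increments. \<open>G i\<close> sees only the samples before
  \<open>i\<close> and has mean zero in the new one, so integrating out the last coordinate kills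
  its product with everything earlier.\<close>

lemma nn_integral_martingale_square:
  fixes G :: "nat \<Rightarrow> (nat \<Rightarrow> 'a) \<Rightarrow> 'a \<Rightarrow> real"
  assumes dep: "\<And>i x x'. (\<And>j. j \<in> {1..<i} \<Longrightarrow> x j = x' j) \<Longrightarrow> G i x = G i x'"
    and sq: "\<And>i x. integrable (measure_pmf p) (\<lambda>y. (G i x y)\<^sup>2)"
    and mean: "\<And>i x. measure_pmf.expectation p (G i x) = 0"
  shows "(\<integral>\<^sup>+x. ennreal ((\<Sum>i=1..n. G i x (x i))\<^sup>2) \<partial>Pi_pmf {1..n} d (\<lambda>_. p)) =
    (\<Sum>i=1..n. \<integral>\<^sup>+x. (\<integral>\<^sup>+y. ennreal ((G i x y)\<^sup>2) \<partial>p) \<partial>Pi_pmf {1..<i} d (\<lambda>_. p))"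
proof (induction n)
  case (Suc n)
  have i: "integrable (measure_pmf p) (G i x)" for i x
    by (rule finite_measure.square_integrable_imp_integrable) (use sq in \<open>auto simp: measure_pmf.finite_measure_axioms\<close>)
  \<comment> \<open>\<open>a\<close> stands for the sum of the earlier terms, a constant under the
    inner integral.\<close>
  have step: "(\<integral>\<^sup>+y. ennreal ((G i x y + a)\<^sup>2) \<partial>p) = ennreal (a\<^sup>2) + (\<integral>\<^sup>+y. ennreal ((G i x y)\<^sup>2) \<partial>p)" for a i x
  proof -
    have "measure_pmf.expectation p (\<lambda>y. (G i x y + a)\<^sup>2) = a\<^sup>2 + measure_pmf.expectation p (\<lambda>y. (G i x y)\<^sup>2)"
      using i[of i x] sq[of i x] mean[of i x] by (simp add: power2_sum)
    moreover have "integrable (measure_pmf p) (\<lambda>y. (G i x y + a)\<^sup>2)"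
      using i[of i x] sq[of i x] by (simp add: power2_sum)
    ultimately show ?thesis
      using sq[of i x] by (simp add: nn_integral_eq_integral)
  qed
  have upd: "(\<Sum>i=1..n. G i (x(Suc n := y)) (x i)) = (\<Sum>i=1..n. G i x (x i))" for x y
    by (intro sum.cong refl) (auto intro!: fun_cong[OF dep])
  have upd': "G (Suc n) (x(Suc n := y)) = G (Suc n) x" for x y
    by (rule dep) auto
  have "{1..Suc n} = insert (Suc n) {1..n}" by auto
  then show ?case
    using Suc.IH
    by (simp add: nn_integral_Pi_pmf_insert upd[simplified] upd' step nn_integral_add
        atLeastLessThanSuc_atLeastAtMost add.commute)
qed simp

text \<open>\<open>measure_pmf q\<close> lives on the full power set, whereas members of
  \<open>P_space\<close> carry the Borel sets; the push-forward under the identity changes only the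
  sigma-algebra.\<close>

definition borel_pmf :: "'a::topological_space pmf \<Rightarrow> 'a measure" where
  "borel_pmf q = distr (measure_pmf q) borel (\<lambda>x. x)"

lemma sets_borel_pmf [simp]: "sets (borel_pmf q) = sets borel"
  by (simp add: borel_pmf_def)

lemma emeasure_borel_pmf: "A \<in> sets borel \<Longrightarrow> emeasure (borel_pmf q) A = emeasure (measure_pmf q) A"
  by (simp add: borel_pmf_def emeasure_distr)

lemma expectation_borel_pmf:
  fixes f :: "'a::topological_space \<Rightarrow> real"
  assumes "f \<in> borel_measurable borel"
  shows "(\<integral>y. f y \<partial>borel_pmf q) = measure_pmf.expectation q f"
    and "integrable (borel_pmf q) f \<longleftrightarrow> integrable (measure_pmf q) f"
  using assms by (simp_all add: borel_pmf_def integral_distr integrable_distr_eq)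

lemma borel_pmf_in_P_space:
  "borel_pmf q \<in> P_space l \<longleftrightarrow> integrable (measure_pmf q) (\<lambda>x. rpow (norm x) l)"
  by (auto simp: P_space_def expectation_borel_pmf measure_pmf.prob_space_distr borel_pmf_def[of q]
      simp flip: expectation_borel_pmf(2))

text \<open>Encoded as a two-stage draw: a uniform index \<open>j\<close> yields the stored point
  \<open>x j\<close> if \<open>j \<le> n\<close>, and a fresh sample of \<open>p\<close> otherwise.
  It is thereby a probability by construction.\<close>

definition partial_empirical :: "'a pmf \<Rightarrow> nat \<Rightarrow> nat \<Rightarrow> (nat \<Rightarrow> 'a) \<Rightarrow> 'a pmf" where
  "partial_empirical p N n x =
     bind_pmf (pmf_of_set {1..N}) (\<lambda>j. if j \<le> n then return_pmf (x j) else p)"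

lemma partial_empirical_0: "N \<ge> 1 \<Longrightarrow> partial_empirical p N 0 x = p"
  unfolding partial_empirical_def
  by (subst bind_pmf_cong[OF refl, of _ _ "\<lambda>_. p"]) auto

lemma partial_empirical_cong:
  assumes "N \<ge> 1" "\<And>j. 1 \<le> j \<Longrightarrow> j \<le> n \<Longrightarrow> x j = x' j"
  shows "partial_empirical p N n x = partial_empirical p N n x'"
  unfolding partial_empirical_def using assms by (intro bind_pmf_cong refl) auto

lemma set_partial_empirical:
  assumes "N \<ge> 1" "\<And>j. 1 \<le> j \<Longrightarrow> j \<le> n \<Longrightarrow> x j \<in> set_pmf p"
  shows "set_pmf (partial_empirical p N n x) \<subseteq> set_pmf p"
  using assms by (auto simp: partial_empirical_def split: if_splits)

text \<open>The slots above \<open>n\<close> carry \<open>p\<close> itself and cancel. A sum of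
  \<open>n\<close> centred terms remains, still divided by \<open>N\<close>.\<close>

lemma pmf_partial_empirical:
  assumes "N \<ge> 1" "n \<le> N"
  shows "pmf (partial_empirical p N n x) y - pmf p y = (\<Sum>j=1..n. indicator {x j} y - pmf p y) / N"
proof -
  have "pmf (partial_empirical p N n x) y - pmf p y =
      (\<Sum>j=1..N. pmf (if j \<le> n then return_pmf (x j) else p) y) / N - (\<Sum>j=1..N. pmf p y) / N"
    using assms by (simp add: partial_empirical_def pmf_bind integral_pmf_of_set)
  also have "\<dots> = (\<Sum>j=1..N. if j \<le> n then indicator {x j} y - pmf p y else 0) / N"
    unfolding diff_divide_distrib[symmetric] sum_subtractf[symmetric]
    by (intro arg_cong2[where f="(/)"] sum.cong refl) (auto simp: indicator_def)
  also have "(\<Sum>j=1..N. if j \<le> n then indicator {x j} y - pmf p y else 0) = (\<Sum>j=1..n. indicator {x j} y - pmf p y)"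
    using assms by (intro sum.mono_neutral_cong_right) auto
  finally show ?thesis .
qed

lemma expectation_partial_empirical:
  fixes h :: "'a \<Rightarrow> real"
  assumes "N \<ge> 1" and h: "integrable (measure_pmf p) h"
  shows "integrable (measure_pmf (partial_empirical p N n x)) h"
    and "measure_pmf.expectation (partial_empirical p N n x) h =
      (\<Sum>j=1..N. if j \<le> n then h (x j) else measure_pmf.expectation p h) / N"
proof -
  have "integrable (measure_pmf (if j \<le> n then return_pmf (x j) else p)) h" for j
    using h by (auto simp: integrable_measure_pmf_finite)
  then show "integrable (measure_pmf (partial_empirical p N n x)) h"
    "measure_pmf.expectation (partial_empirical p N n x) h =
      (\<Sum>j=1..N. if j \<le> n then h (x j) else measure_pmf.expectation p h) / N"
    using assms(1) by (auto simp: partial_empirical_def expectation_bind_pmf_of_set intro!: sum.cong)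
qed

text \<open>The two laws differ in slot \<open>n\<close> alone, where the point \<open>x n\<close>
  replaces \<open>p\<close>.\<close>

lemma expectation_partial_empirical_diff:
  fixes h :: "'a \<Rightarrow> real"
  assumes h: "integrable (measure_pmf p) h" and n: "1 \<le> n" "n \<le> N"
  shows "measure_pmf.expectation (partial_empirical p N n x) h -
      measure_pmf.expectation (partial_empirical p N (n - 1) x) h =
    (h (x n) - measure_pmf.expectation p h) / N"
proof -
  have N: "N \<ge> 1" using n by simp
  have *: "(if j \<le> n then h (x j) else c) - (if j \<le> n - 1 then h (x j) else c) =
      (if j = n then h (x n) - c else 0)" for j c
    using n by auto
  show ?thesis
    using n by (simp add: expectation_partial_empirical[OF N h] diff_divide_distrib[symmetric]
        sum_subtractf[symmetric] * sum.delta del: One_nat_def)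
qed

lemma empirical_measure_conv_pmf:
  fixes x :: "nat \<Rightarrow> 'a::euclidean_space"
  assumes N: "N \<ge> 1"
  shows "empirical_measure N x = borel_pmf (partial_empirical p N N x)"
proof (rule measure_eqI)
  fix A assume "A \<in> sets (empirical_measure N x)"
  then have A: "A \<in> sets borel" by (simp add: empirical_measure_def sigma_sets_borel)
  have "emeasure (partial_empirical p N N x) A = (\<integral>\<^sup>+z. indicator A z \<partial>partial_empirical p N N x)"
    by simp
  also have "\<dots> = (\<Sum>j=1..N. emeasure (return borel (x j)) A) / ennreal N"
  proof -
    have "(\<Sum>j=1..N. \<integral>\<^sup>+z. indicator A z \<partial>(if j \<le> N then return_pmf (x j) else p)) =
        (\<Sum>j=1..N. emeasure (return borel (x j)) A)"
      using A by (intro sum.cong) auto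
    then show ?thesis
      using N unfolding partial_empirical_def nn_integral_bind_pmf
      by (simp add: nn_integral_pmf_of_set ennreal_of_nat_eq_real_of_nat del: nn_integral_indicator)
  qed
  finally have "emeasure (partial_empirical p N N x) A = (\<Sum>j=1..N. emeasure (return borel (x j)) A) / ennreal N" .
  then show "emeasure (empirical_measure N x) A = emeasure (borel_pmf (partial_empirical p N N x)) A"
    using N A by (simp add: emeasure_empirical_measure emeasure_borel_pmf divide_ennreal_def inverse_ennreal
        inverse_eq_divide mult.commute)
qed (simp add: empirical_measure_def sigma_sets_borel)

section \<open>Weighted total variation\<close>

text \<open>For a probability \<open>p\<close> on a countable set and \<open>q\<close> absolutely continuous with respect to \<open>p\<close>, this is
  the total variation of \<open>q - p\<close> weighted by \<open>1 + w\<close>.\<close>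

definition weighted_tv :: "('a \<Rightarrow> real) \<Rightarrow> 'a pmf \<Rightarrow> 'a pmf \<Rightarrow> real" where
  "weighted_tv w p q = measure_pmf.expectation p (\<lambda>y. (1 + w y) * \<bar>pmf q y / pmf p y - 1\<bar>)"

text \<open>The difference of expectations is the expectation under \<open>p\<close> of
  \<open>f\<close> times the density ratio minus 1, and \<open>a + b * w y\<close> is at most
  \<open>(a + b) * (1 + w y)\<close> because all terms are nonnegative.\<close>

lemma
  fixes w :: "'a \<Rightarrow> real"
  assumes supp: "set_pmf q \<subseteq> set_pmf p" and w: "\<And>y. 0 \<le> w y"
    and p: "integrable (measure_pmf p) w" and q: "integrable (measure_pmf q) w"
  shows integrable_weighted_tv: "integrable (measure_pmf p) (\<lambda>y. (1 + w y) * \<bar>pmf q y / pmf p y - 1\<bar>)"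
    and expectation_diff_le_weighted_tv:
      "\<And>f a b. 0 \<le> a \<Longrightarrow> 0 \<le> b \<Longrightarrow> (\<And>y. \<bar>f y\<bar> \<le> a + b * w y) \<Longrightarrow>
        \<bar>measure_pmf.expectation q f - measure_pmf.expectation p f\<bar> \<le> (a + b) * weighted_tv w p q"
    and weighted_tv_nonneg: "0 \<le> weighted_tv w p q"
proof -
  have 1: "integrable (measure_pmf p) (\<lambda>y. 1 + w y)" and 2: "integrable (measure_pmf q) (\<lambda>y. 1 + w y)"
    using p q by auto
  from 2 have 3: "integrable (measure_pmf p) (\<lambda>y. pmf q y / pmf p y * (1 + w y))"
    by (simp only: expectation_density_ratio[OF supp])
  have "integrable (measure_pmf p) (\<lambda>y. \<bar>pmf q y / pmf p y * (1 + w y) - (1 + w y)\<bar>)"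
    using 1 3 by (intro integrable_abs Bochner_Integration.integrable_diff)
  moreover have eq: "\<bar>pmf q y / pmf p y * (1 + w y) - (1 + w y)\<bar> = (1 + w y) * \<bar>pmf q y / pmf p y - 1\<bar>" for y
  proof -
    have "pmf q y / pmf p y * (1 + w y) - (1 + w y) = (1 + w y) * (pmf q y / pmf p y - 1)"
      by (simp add: algebra_simps)
    then show ?thesis using w[of y] by (simp add: abs_mult)
  qed
  ultimately show int: "integrable (measure_pmf p) (\<lambda>y. (1 + w y) * \<bar>pmf q y / pmf p y - 1\<bar>)"
    by simp
  show "0 \<le> weighted_tv w p q"
    unfolding weighted_tv_def using w by (intro integral_nonneg_AE) (auto intro!: AE_I2 mult_nonneg_nonneg)
  fix f :: "'a \<Rightarrow> real" and a b
  assume ab: "0 \<le> a" "0 \<le> b" and f: "\<And>y. \<bar>f y\<bar> \<le> a + b * w y"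
  have ifn: "integrable (measure_pmf r) f" if "integrable (measure_pmf r) w" for r
    by (rule Bochner_Integration.integrable_bound[of _ "\<lambda>y. a + b * w y"])
       (use that f in \<open>auto intro: order_trans[OF _ abs_ge_self]\<close>)
  have f3: "integrable (measure_pmf p) (\<lambda>y. pmf q y / pmf p y * f y)"
    using ifn[OF q] by (simp only: expectation_density_ratio[OF supp])
  have "\<bar>measure_pmf.expectation q f - measure_pmf.expectation p f\<bar> =
      \<bar>measure_pmf.expectation p (\<lambda>y. pmf q y / pmf p y * f y - f y)\<bar>"
    using ifn[OF p] f3 by (simp add: expectation_density_ratio(2)[OF supp])
  also have "\<dots> \<le> measure_pmf.expectation p (\<lambda>y. \<bar>pmf q y / pmf p y * f y - f y\<bar>)"
    by (rule integral_abs_bound)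
  also have "\<dots> \<le> measure_pmf.expectation p (\<lambda>y. (a + b) * ((1 + w y) * \<bar>pmf q y / pmf p y - 1\<bar>))"
  proof (rule integral_mono)
    fix y
    have "pmf q y / pmf p y * f y - f y = f y * (pmf q y / pmf p y - 1)" by (simp add: algebra_simps)
    then have "\<bar>pmf q y / pmf p y * f y - f y\<bar> = \<bar>f y\<bar> * \<bar>pmf q y / pmf p y - 1\<bar>" by (simp add: abs_mult)
    also have "\<dots> \<le> ((a + b) * (1 + w y)) * \<bar>pmf q y / pmf p y - 1\<bar>"
    proof (rule mult_right_mono)
      have "0 \<le> a * w y" using ab w by simp
      then show "\<bar>f y\<bar> \<le> (a + b) * (1 + w y)" using f[of y] ab by (simp add: algebra_simps)
    qed simp
    finally show "\<bar>pmf q y / pmf p y * f y - f y\<bar> \<le> (a + b) * ((1 + w y) * \<bar>pmf q y / pmf p y - 1\<bar>)"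
      by (simp only: mult.assoc)
  qed (use f3 ifn[OF p] int in auto)
  also have "\<dots> = (a + b) * weighted_tv w p q"
    by (simp add: weighted_tv_def)
  finally show "\<bar>measure_pmf.expectation q f - measure_pmf.expectation p f\<bar> \<le> (a + b) * weighted_tv w p q" .
qed

text \<open>The square root comes from the variance of an empirical frequency and vanishes as
  \<open>N\<close> grows, but its average over the atoms may be infinite. The constant 2, from the
  triangle inequality, supplies the integrable majorant.\<close>

lemma nn_integral_pmf_partial_empirical:
  assumes N: "N \<ge> 1" "n \<le> N" and y: "y \<in> set_pmf p"
  shows "(\<integral>\<^sup>+x. ennreal \<bar>pmf (partial_empirical p N n x) y / pmf p y - 1\<bar> \<partial>Pi_pmf {1..n} d (\<lambda>_. p))
    \<le> ennreal (min 2 (sqrt (1 / (real N * pmf p y))))"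
proof -
  let ?Q = "Pi_pmf {1..n} d (\<lambda>_. p)"
  let ?r = "\<lambda>x. pmf (partial_empirical p N n x) y / pmf p y - 1"
  \<comment> \<open>The relative deviation contributed by one sample \<open>z\<close>. It ignores
    the history \<open>x\<close>, so the martingale identity specialises to independent
    terms.\<close>
  define G where "G = (\<lambda>(i::nat) (x::nat \<Rightarrow> 'a) z. indicator {y} z / pmf p y - 1 :: real)"
  have pos: "0 < pmf p y" using y by (rule pmf_positive)
  have r: "?r x = (\<Sum>i=1..n. G i x (x i)) / N" for x
  proof -
    have "?r x = (pmf (partial_empirical p N n x) y - pmf p y) / pmf p y"
      using pos by (simp add: field_simps)
    also have "\<dots> = (\<Sum>j=1..n. (indicator {x j} y - pmf p y) / pmf p y) / N"
      unfolding pmf_partial_empirical[OF N] by (simp add: sum_divide_distrib mult.commute)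
    also have "\<dots> = (\<Sum>j=1..n. G j x (x j)) / N"
      using pos unfolding G_def by (intro arg_cong2[where f="(/)"] sum.cong refl) (auto simp: field_simps indicator_def)
    finally show ?thesis .
  qed
  have [simp]: "integrable (measure_pmf p) (indicator {y} :: 'a \<Rightarrow> real)"
    by (auto intro!: measure_pmf.integrable_const_bound[where B=1] simp: indicator_def)
  have E: "measure_pmf.expectation p (indicator {y}) = pmf p y"
    by (simp add: measure_pmf_single)
  have sq: "(G i x z)\<^sup>2 = (1 / (pmf p y)\<^sup>2 - 2 / pmf p y) * indicator {y} z + 1" for i x z
    using pos by (auto simp: G_def indicator_def power2_eq_square field_simps)
  have "(\<integral>\<^sup>+x. ennreal ((\<Sum>i=1..n. G i x (x i))\<^sup>2) \<partial>?Q) =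
      (\<Sum>i=1..n. \<integral>\<^sup>+x. (\<integral>\<^sup>+y. ennreal ((G i x y)\<^sup>2) \<partial>p) \<partial>Pi_pmf {1..<i} d (\<lambda>_. p))"
  proof (rule nn_integral_martingale_square)
    show "integrable (measure_pmf p) (\<lambda>z. (G i x z)\<^sup>2)" for i x unfolding sq by simp
    show "measure_pmf.expectation p (G i x) = 0" for i x
      using pos by (simp add: G_def measure_pmf_single)
  qed (simp add: G_def)
  also have "(\<lambda>i x. \<integral>\<^sup>+y. ennreal ((G i x y)\<^sup>2) \<partial>p) = (\<lambda>i x. ennreal (1 / pmf p y - 1))"
  proof (intro ext)
    fix i x
    have "(\<integral>\<^sup>+z. ennreal ((G i x z)\<^sup>2) \<partial>p) = ennreal (measure_pmf.expectation p (\<lambda>z. (G i x z)\<^sup>2))"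
      by (rule nn_integral_eq_integral) (simp_all, simp add: sq)
    also have "measure_pmf.expectation p (\<lambda>z. (G i x z)\<^sup>2) = (1 / (pmf p y)\<^sup>2 - 2 / pmf p y) * pmf p y + 1"
      unfolding sq by (simp add: measure_pmf_single)
    also have "\<dots> = 1 / pmf p y - 1"
      using pos by (simp add: power2_eq_square field_simps)
    finally show "(\<integral>\<^sup>+z. ennreal ((G i x z)\<^sup>2) \<partial>p) = ennreal (1 / pmf p y - 1)" .
  qed
  also have "(\<Sum>i=1..n. \<integral>\<^sup>+x. ennreal (1 / pmf p y - 1) \<partial>Pi_pmf {1..<i} d (\<lambda>_. p)) = ennreal (real n * (1 / pmf p y - 1))"
  proof -
    have "0 \<le> 1 / pmf p y - 1" using pmf_le_1[of p y] pos by simp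
    then show ?thesis by (simp add: ennreal_of_nat_eq_real_of_nat flip: ennreal_mult)
  qed
  finally have *: "(\<integral>\<^sup>+x. ennreal ((\<Sum>i=1..n. G i x (x i))\<^sup>2) \<partial>?Q) = ennreal (real n * (1 / pmf p y - 1))" .
  have "(\<integral>\<^sup>+x. ennreal ((?r x)\<^sup>2) \<partial>?Q) = (\<integral>\<^sup>+x. ennreal (1 / (real N)\<^sup>2) * ennreal ((\<Sum>i=1..n. G i x (x i))\<^sup>2) \<partial>?Q)"
    unfolding r by (intro nn_integral_cong) (simp add: power_divide flip: ennreal_mult)
  also have "\<dots> = ennreal (1 / (real N)\<^sup>2 * (real n * (1 / pmf p y - 1)))"
  proof -
    have "0 \<le> 1 / pmf p y - 1" using pmf_le_1[of p y] pos by simp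
    then have "0 \<le> real n * (1 / pmf p y - 1)" by simp
    then show ?thesis by (subst nn_integral_cmult) (auto simp: * simp flip: ennreal_mult simp del: One_nat_def)
  qed
  \<comment> \<open>Replacing \<open>n\<close> by \<open>N\<close> and dropping the
    \<open>- 1\<close> makes the bound uniform in \<open>n\<close>.\<close>
  also have "\<dots> \<le> ennreal (1 / (real N)\<^sup>2 * (real N * (1 / pmf p y)))"
    using N pmf_le_1[of p y] pos by (intro ennreal_leI mult_left_mono mult_mono) auto
  also have "1 / (real N)\<^sup>2 * (real N * (1 / pmf p y)) = 1 / (real N * pmf p y)"
    using N by (simp add: power2_eq_square)
  finally have 1: "(\<integral>\<^sup>+x. ennreal \<bar>?r x\<bar> \<partial>?Q) \<le> ennreal (sqrt (1 / (real N * pmf p y)))"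
    by (intro measure_pmf.nn_integral_abs_le_sqrt) auto
  have abs: "(\<integral>\<^sup>+z. ennreal \<bar>G i x z\<bar> \<partial>p) \<le> 2" for i x
  proof -
    have "(\<integral>\<^sup>+z. ennreal \<bar>G i x z\<bar> \<partial>p) \<le> (\<integral>\<^sup>+z. ennreal (indicator {y} z / pmf p y + 1) \<partial>p)"
    proof (intro nn_integral_mono ennreal_leI)
      fix z
      have "0 \<le> indicator {y} z / pmf p y" by simp
      then show "\<bar>G i x z\<bar> \<le> indicator {y} z / pmf p y + 1" unfolding G_def by linarith
    qed
    also have "\<dots> = ennreal (measure_pmf.expectation p (\<lambda>z. indicator {y} z / pmf p y + 1))"
      using pos by (intro nn_integral_eq_integral) auto
    also have "measure_pmf.expectation p (\<lambda>z. indicator {y} z / pmf p y + 1) = 2"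
      using pos by (simp add: measure_pmf_single)
    finally show ?thesis by simp
  qed
  have "(\<integral>\<^sup>+x. ennreal \<bar>?r x\<bar> \<partial>?Q) \<le> (\<integral>\<^sup>+x. ennreal (1 / real N) * (\<Sum>i=1..n. ennreal \<bar>G i x (x i)\<bar>) \<partial>?Q)"
    unfolding r
    by (intro nn_integral_mono)
       (auto simp: abs_divide divide_right_mono intro!: ennreal_leI simp flip: ennreal_mult)
  also have "\<dots> = ennreal (1 / real N) * (\<Sum>i=1..n. \<integral>\<^sup>+x. ennreal \<bar>G i x (x i)\<bar> \<partial>?Q)"
    by (simp add: nn_integral_cmult nn_integral_sum del: sum_ennreal)
  also have "\<dots> \<le> ennreal (1 / real N) * (\<Sum>i=1..n. 2)"
  proof (intro mult_left_mono sum_mono)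
    fix i assume "i \<in> {1..n}"
    then have "(\<integral>\<^sup>+x. ennreal \<bar>G i x (x i)\<bar> \<partial>?Q) = (\<integral>\<^sup>+z. ennreal \<bar>G i (\<lambda>_. y) z\<bar> \<partial>map_pmf (\<lambda>x. x i) ?Q)"
      by (simp add: G_def)
    also have "map_pmf (\<lambda>x. x i) ?Q = p"
      using \<open>i \<in> {1..n}\<close> by (simp add: Pi_pmf_component)
    finally show "(\<integral>\<^sup>+x. ennreal \<bar>G i x (x i)\<bar> \<partial>?Q) \<le> 2" using abs by simp
  qed simp
  also have "(\<Sum>i=1..n. 2 :: ennreal) = ennreal (real n * 2)"
    by (simp add: ennreal_of_nat_eq_real_of_nat ennreal_mult)
  also have "ennreal (1 / real N) * ennreal (real n * 2) = ennreal (1 / real N * (real n * 2))"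
    by (rule ennreal_mult[symmetric]) auto
  also have "\<dots> \<le> ennreal 2"
    using N by (intro ennreal_leI) (auto simp: field_simps)
  finally have "(\<integral>\<^sup>+x. ennreal \<bar>?r x\<bar> \<partial>?Q) \<le> ennreal 2" .
  with 1 show ?thesis by (simp add: min_def)
qed

text \<open>A bound for the mean weighted total variation between \<open>p\<close> and its partial
  empirical laws, common to all \<open>n \<le> N\<close>.\<close>

definition tv_rate :: "('a \<Rightarrow> real) \<Rightarrow> 'a pmf \<Rightarrow> nat \<Rightarrow> real" where
  "tv_rate w p N = measure_pmf.expectation p (\<lambda>y. (1 + w y) * min 2 (sqrt (1 / (real N * pmf p y))))"

lemma tv_rate_integrand_bound:
  assumes "\<And>y. (0::real) \<le> w y"
  shows "norm ((1 + w y) * min 2 (sqrt (1 / (real N * pmf p y)))) \<le> norm ((1 + w y) * 2)"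
  unfolding norm_mult by (intro mult_left_mono) auto

lemma integrable_tv_rate:
  assumes "\<And>y. 0 \<le> w y" "integrable (measure_pmf p) w"
  shows "integrable (measure_pmf p) (\<lambda>y. (1 + w y) * min 2 (sqrt (1 / (real N * pmf p y))))"
  by (rule Bochner_Integration.integrable_bound[of _ "\<lambda>y. (1 + w y) * 2"])
     (use assms tv_rate_integrand_bound[of w] in auto)

lemma tv_rate_nonneg: "(\<And>y. 0 \<le> w y) \<Longrightarrow> 0 \<le> tv_rate w p N"
  unfolding tv_rate_def by (intro integral_nonneg_AE) (auto intro!: AE_I2 mult_nonneg_nonneg add_nonneg_nonneg)

text \<open>Every point of the support of \<open>p\<close> has positive mass, so
  \<open>real N * pmf p y\<close> diverges there, while \<open>(1 + w y) * 2\<close>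
  dominates.\<close>

lemma tv_rate_tendsto_0:
  assumes w: "\<And>y. 0 \<le> w y" "integrable (measure_pmf p) w"
  shows "(\<lambda>N. tv_rate w p N) \<longlonglongrightarrow> 0"
proof -
  have "(\<lambda>N. tv_rate w p N) \<longlonglongrightarrow> measure_pmf.expectation p (\<lambda>y. (1 + w y) * min 2 (sqrt 0))"
    unfolding tv_rate_def
  proof (rule integral_dominated_convergence[where w="\<lambda>y. (1 + w y) * 2"])
    have "(\<lambda>N. (1 + w y) * min 2 (sqrt (1 / (real N * pmf p y)))) \<longlonglongrightarrow> (1 + w y) * min 2 (sqrt 0)" if "y \<in> set_pmf p" for y
    proof -
      have "filterlim (\<lambda>N. real N * pmf p y) at_top sequentially"
        using pmf_positive[OF that]
        by (auto intro!: filterlim_at_top_mult_tendsto_pos[OF tendsto_const] filterlim_real_sequentially simp: mult.commute)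
      then have "(\<lambda>N. 1 / (real N * pmf p y)) \<longlonglongrightarrow> 0"
        by (intro tendsto_divide_0[OF tendsto_const] filterlim_at_top_imp_at_infinity)
      then show ?thesis by (intro tendsto_intros)
    qed
    then show "AE y in p. (\<lambda>N. (1 + w y) * min 2 (sqrt (1 / (real N * pmf p y)))) \<longlonglongrightarrow> (1 + w y) * min 2 (sqrt 0)"
      by (simp add: AE_measure_pmf_iff)
    show "AE y in p. norm ((1 + w y) * min 2 (sqrt (1 / (real N * pmf p y)))) \<le> (1 + w y) * 2" for N
      using w tv_rate_integrand_bound[of w _ N p] by (intro AE_I2) (simp add: abs_of_nonneg add_nonneg_nonneg)
  qed (use w in auto)
  then show ?thesis by simp
qed

lemma nn_integral_weighted_tv_partial_empirical:
  assumes w: "\<And>y. 0 \<le> w y" "integrable (measure_pmf p) w" and N: "N \<ge> 1" "n \<le> N"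
  shows "(\<integral>\<^sup>+x. ennreal (weighted_tv w p (partial_empirical p N n x)) \<partial>Pi_pmf {1..n} d (\<lambda>_. p)) \<le> ennreal (tv_rate w p N)"
proof -
  let ?Q = "Pi_pmf {1..n} d (\<lambda>_. p)"
  let ?r = "\<lambda>x y. \<bar>pmf (partial_empirical p N n x) y / pmf p y - 1\<bar>"
  have "(\<integral>\<^sup>+x. ennreal (weighted_tv w p (partial_empirical p N n x)) \<partial>?Q) =
      (\<integral>\<^sup>+x. (\<integral>\<^sup>+y. ennreal ((1 + w y) * ?r x y) \<partial>p) \<partial>?Q)"
  \<comment> \<open>Almost every sample consists of atoms of \<open>p\<close>; the supports are then
    nested and the integrand is integrable, as the passage from the real to the nonnegative integral
    requires.\<close>
  proof (intro nn_integral_cong_AE, unfold AE_measure_pmf_iff, intro ballI)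
    fix x assume "x \<in> set_pmf ?Q"
    then have "set_pmf (partial_empirical p N n x) \<subseteq> set_pmf p"
      by (intro set_partial_empirical N) (auto simp: set_Pi_pmf PiE_dflt_def)
    from integrable_weighted_tv[OF this w expectation_partial_empirical(1)[OF N(1) w(2)]]
    show "ennreal (weighted_tv w p (partial_empirical p N n x)) = (\<integral>\<^sup>+y. ennreal ((1 + w y) * ?r x y) \<partial>p)"
      unfolding weighted_tv_def using w
      by (intro nn_integral_eq_integral[symmetric]) (auto intro!: AE_I2 mult_nonneg_nonneg add_nonneg_nonneg)
  qed
  also have "\<dots> = (\<integral>\<^sup>+y. (\<integral>\<^sup>+x. ennreal (1 + w y) * ennreal (?r x y) \<partial>?Q) \<partial>p)"
    using w by (subst nn_integral_pmf_commute) (simp add: ennreal_mult)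
  also have "\<dots> = (\<integral>\<^sup>+y. ennreal (1 + w y) * (\<integral>\<^sup>+x. ennreal (?r x y) \<partial>?Q) \<partial>p)"
    by (simp add: nn_integral_cmult)
  also have "\<dots> \<le> (\<integral>\<^sup>+y. ennreal (1 + w y) * ennreal (min 2 (sqrt (1 / (real N * pmf p y)))) \<partial>p)"
    using nn_integral_pmf_partial_empirical[OF N]
    by (intro nn_integral_mono_AE) (auto simp: AE_measure_pmf_iff intro!: mult_left_mono)
  also have "\<dots> = (\<integral>\<^sup>+y. ennreal ((1 + w y) * min 2 (sqrt (1 / (real N * pmf p y)))) \<partial>p)"
    using w by (simp add: ennreal_mult)
  also have "\<dots> = ennreal (tv_rate w p N)"
    unfolding tv_rate_def using w integrable_tv_rate[OF w]
    by (intro nn_integral_eq_integral) (auto intro!: AE_I2 mult_nonneg_nonneg add_nonneg_nonneg)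
  finally show ?thesis .
qed

section \<open>Second-order expansion of one resampling step\<close>

text \<open>\<open>D\<close> and \<open>D2\<close> play the roles of the first and second
  derivative. Powers of order \<open>l / 2\<close> appear as square roots, and one constant serves
  both bounds. The asymmetry of \<open>D2_bound\<close> matters: the variable \<open>x\<close>, in
  which squares are taken later, enters with half the order of \<open>y\<close>.\<close>

locale smooth_functional =
  fixes l :: real and U :: "'a::euclidean_space measure \<Rightarrow> real"
    and D :: "'a measure \<Rightarrow> 'a \<Rightarrow> real" and D2 :: "'a measure \<Rightarrow> 'a \<Rightarrow> 'a \<Rightarrow> real" and C :: real
  assumes has_lfd_D: "m \<in> P_space l \<Longrightarrow> has_lfd l U m (D m)"
    and has_lfd_D2: "m \<in> P_space l \<Longrightarrow> has_lfd l (\<lambda>m. D m x) m (D2 m x)"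
    and C_nonneg: "0 \<le> C"
    and D_bound: "m \<in> P_space l \<Longrightarrow>
      \<bar>D m x\<bar> \<le> C * (1 + sqrt (rpow (norm x) l) + sqrt (\<integral>z. rpow (norm z) l \<partial>m))"
    and D2_bound: "m \<in> P_space l \<Longrightarrow>
      \<bar>D2 m x y\<bar> \<le> C * (1 + sqrt (rpow (norm x) l) + rpow (norm y) l + (\<integral>z. rpow (norm z) l \<partial>m))"
begin

abbreviation w :: "'a \<Rightarrow> real" where "w x \<equiv> rpow (norm x) l"

lemma D_measurable [measurable]: "m \<in> P_space l \<Longrightarrow> D m \<in> borel_measurable borel"
  using has_lfd_D by (simp add: has_lfd_def)

lemma D2_measurable [measurable]: "m \<in> P_space l \<Longrightarrow> D2 m x \<in> borel_measurable borel"
  using has_lfd_D2[of m x] by (simp add: has_lfd_def)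

lemma integrable_D:
  assumes "m \<in> P_space l" "integrable (measure_pmf q) w"
  shows "integrable (measure_pmf q) (D m)"
  using has_lfd_integrable[OF has_lfd_D[OF assms(1)], of "borel_pmf q"] assms
  by (simp add: borel_pmf_in_P_space expectation_borel_pmf D_measurable)

lemma integrable_D2:
  assumes "m \<in> P_space l" "integrable (measure_pmf q) w"
  shows "integrable (measure_pmf q) (D2 m x)"
  using has_lfd_integrable[OF has_lfd_D2[OF assms(1), of x], of "borel_pmf q"] assms
  by (simp add: borel_pmf_in_P_space expectation_borel_pmf D2_measurable)

text \<open>The mean value theorem returns a mixture at an unknown parameter; a convex combination
  keeps its moment below any common bound of the endpoints.\<close>

lemma w_moment_mixture_le:
  assumes P: "\<mu> \<in> P_space l" "\<nu> \<in> P_space l" and s: "0 \<le> s" "s \<le> 1"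
    and B: "(\<integral>z. w z \<partial>\<mu>) \<le> B" "(\<integral>z. w z \<partial>\<nu>) \<le> B"
  shows "(\<integral>z. w z \<partial>mixture s \<mu> \<nu>) \<le> B"
proof -
  have "(\<integral>z. w z \<partial>mixture s \<mu> \<nu>) = (1 - s) * (\<integral>z. w z \<partial>\<mu>) + s * (\<integral>z. w z \<partial>\<nu>)"
    using P_space_D[OF P(1)] P_space_D[OF P(2)] s by (simp add: integral_mixture)
  also have "\<dots> \<le> B" using B s by (intro convex_bound_le) auto
  finally show ?thesis .
qed

text \<open>Growth of half the order \<open>l\<close> makes the square comparable with
  \<open>w\<close>. The 3 comes from squaring a sum of three terms.\<close>

lemma D_square_le:
  assumes "m \<in> P_space l"
  shows "(D m x)\<^sup>2 \<le> 3 * C\<^sup>2 * (1 + w x + (\<integral>z. w z \<partial>m))"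
proof -
  have M: "0 \<le> (\<integral>z. w z \<partial>m)" by (intro integral_nonneg_AE) auto
  have "\<bar>D m x\<bar>\<^sup>2 \<le> (C * (1 + sqrt (w x) + sqrt (\<integral>z. w z \<partial>m)))\<^sup>2"
    by (intro power_mono D_bound assms) auto
  also have "\<dots> = C\<^sup>2 * (1 + sqrt (w x) + sqrt (\<integral>z. w z \<partial>m))\<^sup>2" by (simp add: power_mult_distrib)
  also have "\<dots> \<le> C\<^sup>2 * (3 * (1 + (sqrt (w x))\<^sup>2 + (sqrt (\<integral>z. w z \<partial>m))\<^sup>2))"
  proof (intro mult_left_mono)
    have "(1 + a + b)\<^sup>2 \<le> 3 * (1 + a\<^sup>2 + b\<^sup>2)" for a b :: real
      using zero_le_power2[of "1 - a"] zero_le_power2[of "1 - b"] zero_le_power2[of "a - b"]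
      by (simp add: power2_eq_square algebra_simps)
    then show "(1 + sqrt (w x) + sqrt (\<integral>z. w z \<partial>m))\<^sup>2 \<le> 3 * (1 + (sqrt (w x))\<^sup>2 + (sqrt (\<integral>z. w z \<partial>m))\<^sup>2)" .
  qed auto
  finally show ?thesis using M by (simp add: algebra_simps)
qed

lemma integrable_D_square:
  assumes "m \<in> P_space l" "integrable (measure_pmf q) w"
  shows "integrable (measure_pmf q) (\<lambda>x. (D m x)\<^sup>2)"
  by (rule Bochner_Integration.integrable_bound[of _ "\<lambda>x. 3 * C\<^sup>2 * (1 + w x + (\<integral>z. w z \<partial>m))"])
     (use assms D_square_le[OF assms(1)] in \<open>auto intro!: AE_I2 order_trans[OF _ abs_ge_self]\<close>)

text \<open>A cruder bound free of square roots, for the estimate in which \<open>D2\<close> enters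
  linearly.\<close>

lemma D2_bound_weak:
  assumes m: "m \<in> P_space l" "(\<integral>z. w z \<partial>m) \<le> B"
  shows "\<bar>D2 m x y\<bar> \<le> C * (2 + w x + w y + B)"
proof -
  have "\<bar>D2 m x y\<bar> \<le> C * (1 + sqrt (w x) + w y + (\<integral>z. w z \<partial>m))" by (rule D2_bound[OF m(1)])
  also have "\<dots> \<le> C * (2 + w x + w y + B)"
    using m(2) sqrt_le_1_plus[of "w x"] C_nonneg by (intro mult_left_mono) auto
  finally show ?thesis .
qed

end

locale smooth_functional_pmf = smooth_functional l U D D2 C
  for l and U :: "'a::euclidean_space measure \<Rightarrow> real" and D D2 C +
  fixes p :: "'a pmf"
  assumes p_moment: "integrable (measure_pmf p) w"
begin

abbreviation "m0 \<equiv> borel_pmf p"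
abbreviation "M0 \<equiv> measure_pmf.expectation p w"
abbreviation "\<kappa> N n x \<equiv> partial_empirical p N n x"

lemma M0_nonneg: "0 \<le> M0"
  by (intro integral_nonneg_AE) auto

lemma m0_in_P_space: "m0 \<in> P_space l"
  using p_moment by (simp add: borel_pmf_in_P_space)

lemma kappa_moment: "N \<ge> 1 \<Longrightarrow> integrable (measure_pmf (\<kappa> N n x)) w"
  by (rule expectation_partial_empirical(1)[OF _ p_moment])

lemma kappa_in_P_space: "N \<ge> 1 \<Longrightarrow> borel_pmf (\<kappa> N n x) \<in> P_space l"
  using kappa_moment by (simp add: borel_pmf_in_P_space)

text \<open>Close to \<open>m0\<close> the second derivative controls the increment of \<open>D\<close>; far from \<open>m0\<close>, where the
  moments of \<open>q\<close> are not bounded, the growth of \<open>D\<close> itself is at most the square root of the distance.\<close>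

lemma D_increment_square_le:
  assumes supp: "set_pmf q \<subseteq> set_pmf p" and q: "integrable (measure_pmf q) w"
  shows "(D (borel_pmf q) x - D m0 x)\<^sup>2 \<le> 12 * C\<^sup>2 * (2 + 2 * M0)\<^sup>2 * (1 + w x) * weighted_tv w p q"
proof -
  let ?t = "weighted_tv w p q" and ?q = "borel_pmf q"
  have P: "?q \<in> P_space l" using q by (simp add: borel_pmf_in_P_space)
  have t: "0 \<le> ?t" by (rule weighted_tv_nonneg[OF supp _ p_moment q]) simp
  have wq: "measure_pmf.expectation q w \<le> M0 + ?t"
    using expectation_diff_le_weighted_tv[OF supp _ p_moment q, of 0 1 w] by simp
  have w_q: "(\<integral>z. w z \<partial>?q) = measure_pmf.expectation q w" and w_m: "(\<integral>z. w z \<partial>m0) = M0"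
    by (simp_all add: expectation_borel_pmf)
  \<comment> \<open>The factor \<open>(2 + 2 * M0)\<^sup>2\<close> serves both cases: near
    \<open>m0\<close> it dominates the square of \<open>3 + M0\<close> up to a constant, and far
    from it absorbs \<open>2 + M0\<close>.\<close>
  have "1 \<le> (2 + 2 * M0)\<^sup>2" using M0_nonneg by (intro one_le_power) simp
  have a2: "2 + 2 * M0 \<le> (2 + 2 * M0)\<^sup>2"
    using M0_nonneg by (intro self_le_power) auto
  show ?thesis
  proof (cases "?t \<le> 1")
    case True
    obtain s where s: "0 < s" "s < 1" "D ?q x - D m0 x =
        (\<integral>y. D2 (mixture s m0 ?q) x y \<partial>?q) - (\<integral>y. D2 (mixture s m0 ?q) x y \<partial>m0)"
      using lfd_mean_value[OF has_lfd_D2 m0_in_P_space P, of x] by blast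
    let ?m = "mixture s m0 ?q"
    have mP: "?m \<in> P_space l" using s by (intro mixture_in_P_space m0_in_P_space P) auto
    have wm: "(\<integral>z. w z \<partial>?m) \<le> M0 + 1"
      using s wq True by (intro w_moment_mixture_le m0_in_P_space P) (auto simp: w_q w_m)
    \<comment> \<open>As a function of \<open>y\<close> the second derivative is at most a constant
      plus \<open>C * w y\<close>. The constant involves \<open>x\<close> only through
      \<open>sqrt (w x)\<close>, so its square is of order \<open>w x\<close>.\<close>
    have "\<bar>measure_pmf.expectation q (D2 ?m x) - measure_pmf.expectation p (D2 ?m x)\<bar>
        \<le> (C * (2 + M0 + sqrt (w x)) + C) * ?t"
    proof (rule expectation_diff_le_weighted_tv[OF supp _ p_moment q])
      fix y
      have "\<bar>D2 ?m x y\<bar> \<le> C * (1 + sqrt (w x) + w y + (\<integral>z. w z \<partial>?m))" by (rule D2_bound[OF mP])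
      also have "\<dots> \<le> C * (1 + sqrt (w x) + w y + (M0 + 1))"
        using wm C_nonneg by (intro mult_left_mono add_left_mono)
      finally show "\<bar>D2 ?m x y\<bar> \<le> C * (2 + M0 + sqrt (w x)) + C * w y" by (simp add: algebra_simps)
    qed (use C_nonneg M0_nonneg in auto)
    also have "measure_pmf.expectation q (D2 ?m x) - measure_pmf.expectation p (D2 ?m x) = D ?q x - D m0 x"
      using s(3) mP by (simp add: expectation_borel_pmf D2_measurable)
    finally have "(D ?q x - D m0 x)\<^sup>2 \<le> ((C * (2 + M0 + sqrt (w x)) + C) * ?t)\<^sup>2"
      using abs_le_square_iff[of "D ?q x - D m0 x" "(C * (2 + M0 + sqrt (w x)) + C) * ?t"] by linarith
    also have "\<dots> = C\<^sup>2 * (3 + M0 + sqrt (w x))\<^sup>2 * ?t\<^sup>2"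
      by (simp add: power2_eq_square algebra_simps)
    also have "\<dots> \<le> C\<^sup>2 * (12 * (2 + 2 * M0)\<^sup>2 * (1 + w x)) * ?t"
    proof (intro mult_mono)
      have "(3 + M0 + sqrt (w x))\<^sup>2 \<le> 2 * ((3 + M0)\<^sup>2 + (sqrt (w x))\<^sup>2)"
        using zero_le_power2[of "3 + M0 - sqrt (w x)"] by (simp add: power2_eq_square algebra_simps)
      also have "\<dots> = 2 * (3 + M0)\<^sup>2 + 2 * w x" by simp
      also have "\<dots> \<le> 12 * (2 + 2 * M0)\<^sup>2 + 12 * (2 + 2 * M0)\<^sup>2 * w x"
      proof (intro add_mono)
        show "2 * (3 + M0)\<^sup>2 \<le> 12 * (2 + 2 * M0)\<^sup>2"
          using M0_nonneg by (simp add: power2_eq_square algebra_simps)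
        show "2 * w x \<le> 12 * (2 + 2 * M0)\<^sup>2 * w x"
          using \<open>1 \<le> (2 + 2 * M0)\<^sup>2\<close> by (intro mult_right_mono rpow_nonneg) linarith
      qed
      finally show "(3 + M0 + sqrt (w x))\<^sup>2 \<le> 12 * (2 + 2 * M0)\<^sup>2 * (1 + w x)" by (simp add: algebra_simps)
      \<comment> \<open>One power of the distance is given away to match the far case, where the
        growth of \<open>D\<close> yields a linear bound.\<close>
      show "?t\<^sup>2 \<le> ?t" using True t by (simp add: power2_eq_square mult_left_le)
    qed (use C_nonneg t in auto)
    finally show ?thesis by (simp add: mult_ac)
  next
    case False
    then have t1: "1 \<le> ?t" by simp
    have "(D ?q x - D m0 x)\<^sup>2 \<le> 2 * (D ?q x)\<^sup>2 + 2 * (D m0 x)\<^sup>2"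
      using zero_le_power2[of "D ?q x + D m0 x"] by (simp add: power2_eq_square algebra_simps)
    also have "\<dots> \<le> 2 * (3 * C\<^sup>2 * (1 + w x + (M0 + ?t))) + 2 * (3 * C\<^sup>2 * (1 + w x + (M0 + ?t)))"
    proof (intro add_mono mult_left_mono)
      show "(D ?q x)\<^sup>2 \<le> 3 * C\<^sup>2 * (1 + w x + (M0 + ?t))"
        using wq by (intro order_trans[OF D_square_le[OF P]] mult_left_mono add_left_mono) (auto simp: w_q)
      show "(D m0 x)\<^sup>2 \<le> 3 * C\<^sup>2 * (1 + w x + (M0 + ?t))"
        using t by (intro order_trans[OF D_square_le[OF m0_in_P_space]] mult_left_mono add_left_mono) (auto simp: w_m)
    qed auto
    also have "\<dots> = 12 * C\<^sup>2 * (1 + w x + M0 + ?t)" by (simp add: algebra_simps)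
    also have "\<dots> \<le> 12 * C\<^sup>2 * ((2 + 2 * M0)\<^sup>2 * (1 + w x) * ?t)"
    proof (intro mult_left_mono)
      \<comment> \<open>Since \<open>?t\<close> is at least 1, it may multiply the terms that lack
        it.\<close>
      have "1 + w x + M0 + ?t \<le> (1 + w x + M0) * ?t + ?t"
        using mult_left_mono[OF t1, of "1 + w x + M0"] M0_nonneg by simp
      also have "\<dots> = (2 + w x + M0) * ?t" by (simp add: algebra_simps)
      also have "\<dots> \<le> ((2 + 2 * M0) * (1 + w x)) * ?t"
      proof -
        have "0 \<le> M0 * w x" using M0_nonneg by simp
        then show ?thesis using t M0_nonneg by (intro mult_right_mono) (auto simp: algebra_simps)
      qed
      also have "\<dots> \<le> ((2 + 2 * M0)\<^sup>2 * (1 + w x)) * ?t"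
        using t a2 by (intro mult_right_mono) (auto intro: add_nonneg_nonneg)
      finally show "1 + w x + M0 + ?t \<le> (2 + 2 * M0)\<^sup>2 * (1 + w x) * ?t" .
    qed auto
    finally show ?thesis by (simp add: mult_ac)
  qed
qed

text \<open>The error of linearising step \<open>i\<close> at the measure reached before
  \<open>x i\<close> is seen. With the derivative taken there, the linear term has mean zero given
  the earlier samples.\<close>

definition "remainder N i x = U (borel_pmf (\<kappa> N i x)) - U (borel_pmf (\<kappa> N (i - 1) x)) -
  (D (borel_pmf (\<kappa> N (i - 1) x)) (x i) - measure_pmf.expectation p (D (borel_pmf (\<kappa> N (i - 1) x)))) / N"

text \<open>Two mean value theorems are nested: one for \<open>U\<close> along the step, one for its
  derivative between the start and the intermediate point. The step changes one slot out of
  \<open>N\<close>, so each contributes a factor \<open>1 / N\<close>.\<close>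

lemma remainder_le:
  assumes i: "1 \<le> i" "i \<le> N"
  shows "\<bar>remainder N i x\<bar> \<le> 4 * C / N\<^sup>2 * (2 + w (x i) + 2 * M0 + (\<Sum>j=1..N. w (x j)) / N)"
proof -
  define \<mu> \<nu> where "\<mu> = borel_pmf (\<kappa> N (i - 1) x)" and "\<nu> = borel_pmf (\<kappa> N i x)"
  \<comment> \<open>\<open>B\<close> bounds the moment of the partial empirical law for any number
    of filled slots, hence also of every mixture met below.\<close>
  define B where "B = M0 + (\<Sum>j=1..N. w (x j)) / N"
  let ?E = "measure_pmf.expectation p"
  have N: "N \<ge> 1" using i by simp
  have P: "\<mu> \<in> P_space l" "\<nu> \<in> P_space l" unfolding \<mu>_def \<nu>_def by (intro kappa_in_P_space N)+
  have kB: "measure_pmf.expectation (\<kappa> N n x) w \<le> B" for n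
  proof -
    have "measure_pmf.expectation (\<kappa> N n x) w \<le> (\<Sum>j=1..N. w (x j) + M0) / N"
      unfolding expectation_partial_empirical(2)[OF N p_moment]
      using M0_nonneg by (intro divide_right_mono sum_mono) auto
    also have "\<dots> = B" using N by (simp add: B_def sum.distrib add_divide_distrib)
    finally show ?thesis .
  qed
  have B: "(\<integral>z. w z \<partial>\<mu>) \<le> B" "(\<integral>z. w z \<partial>\<nu>) \<le> B"
    using kB by (simp_all add: \<mu>_def \<nu>_def expectation_borel_pmf)
  have diff: "(\<integral>y. h y \<partial>\<nu>) - (\<integral>y. h y \<partial>\<mu>) = (h (x i) - ?E h) / N"
    if "h \<in> borel_measurable borel" "integrable (measure_pmf p) h" for h
    using expectation_partial_empirical_diff[OF that(2) i] that(1)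
    by (simp add: \<mu>_def \<nu>_def expectation_borel_pmf)
  obtain s where s: "0 < s" "s < 1"
    and U: "U \<nu> - U \<mu> = (\<integral>y. D (mixture s \<mu> \<nu>) y \<partial>\<nu>) - (\<integral>y. D (mixture s \<mu> \<nu>) y \<partial>\<mu>)"
    using lfd_mean_value[OF has_lfd_D P] by blast
  let ?m = "mixture s \<mu> \<nu>"
  have m: "?m \<in> P_space l" using s by (intro mixture_in_P_space P) auto
  have mB: "(\<integral>z. w z \<partial>?m) \<le> B" using s by (intro w_moment_mixture_le P B) auto
  define H where "H y = D ?m y - D \<mu> y" for y
  have Hi: "integrable (measure_pmf p) H"
    unfolding H_def by (intro Bochner_Integration.integrable_diff integrable_D m P p_moment)
  have H_bound: "\<bar>H y\<bar> \<le> C / N * (4 + 2 * w y + w (x i) + M0 + 2 * B)" for y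
  proof -
    obtain r where r: "0 < r" "r < 1"
      and HD: "D ?m y - D \<mu> y = (\<integral>z. D2 (mixture r \<mu> ?m) y z \<partial>?m) - (\<integral>z. D2 (mixture r \<mu> ?m) y z \<partial>\<mu>)"
      using lfd_mean_value[OF has_lfd_D2 P(1) m, of y] by blast
    let ?r = "mixture r \<mu> ?m"
    have rP: "?r \<in> P_space l" using r by (intro mixture_in_P_space P m) auto
    have rB: "(\<integral>z. w z \<partial>?r) \<le> B" using r by (intro w_moment_mixture_le P m B mB) auto
    have D2i: "integrable \<mu> (D2 ?r y)" "integrable \<nu> (D2 ?r y)" "integrable (measure_pmf p) (D2 ?r y)"
      using has_lfd_integrable[OF has_lfd_D2[OF rP]] P integrable_D2[OF rP p_moment] by auto
    \<comment> \<open>The intermediate point lies a fraction \<open>s\<close> along the way from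
      \<open>\<mu>\<close> to \<open>\<nu>\<close>, so this increment is \<open>s\<close> times that
      of the full step.\<close>
    have "H y = s * ((\<integral>z. D2 ?r y z \<partial>\<nu>) - (\<integral>z. D2 ?r y z \<partial>\<mu>))"
      using s HD D2i P_space_D(2)[OF P(1)] P_space_D(2)[OF P(2)]
      by (simp add: H_def integral_mixture algebra_simps)
    also have "\<dots> = s * ((D2 ?r y (x i) - ?E (D2 ?r y)) / N)"
      by (subst diff) (use rP D2i in \<open>auto intro: D2_measurable\<close>)
    finally have "\<bar>H y\<bar> = s * (\<bar>D2 ?r y (x i) - ?E (D2 ?r y)\<bar> / N)"
      using s by (simp add: abs_mult)
    also have "\<dots> \<le> 1 * (\<bar>D2 ?r y (x i) - ?E (D2 ?r y)\<bar> / N)"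
      using s by (intro mult_right_mono) auto
    also have "\<dots> \<le> (C * (2 + w y + w (x i) + B) + C * (2 + w y + M0 + B)) / N"
    proof -
      have "\<bar>?E (D2 ?r y)\<bar> \<le> ?E (\<lambda>z. \<bar>D2 ?r y z\<bar>)" by (rule integral_abs_bound)
      also have "\<dots> \<le> ?E (\<lambda>z. C * (2 + w y + w z + B))"
        using D2i p_moment by (intro integral_mono D2_bound_weak rP rB) auto
      also have "\<dots> = C * (2 + w y + M0 + B)" using p_moment by simp
      finally show ?thesis
        using D2_bound_weak[OF rP rB, of y "x i"] by (auto intro!: divide_right_mono)
    qed
    also have "\<dots> = C / N * (4 + 2 * w y + w (x i) + M0 + 2 * B)" by (simp add: algebra_simps add_divide_distrib)
    finally show ?thesis .
  qed
  have "?E (\<lambda>y. \<bar>H y\<bar>) \<le> ?E (\<lambda>y. C / N * (4 + 2 * w y + w (x i) + M0 + 2 * B))"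
    using p_moment Hi by (intro integral_mono H_bound) auto
  also have "\<dots> = C / N * (4 + 3 * M0 + w (x i) + 2 * B)" using p_moment by simp
  finally have EH: "\<bar>?E H\<bar> \<le> C / N * (4 + 3 * M0 + w (x i) + 2 * B)"
    using integral_abs_bound[of "measure_pmf p" H] by linarith
  have "remainder N i x = (D ?m (x i) - ?E (D ?m)) / N - (D \<mu> (x i) - ?E (D \<mu>)) / N"
    unfolding remainder_def \<mu>_def[symmetric] \<nu>_def[symmetric] U
      diff[OF D_measurable[OF m] integrable_D[OF m p_moment]] ..
  also have "\<dots> = (H (x i) - ?E H) / N"
  proof -
    have "?E H = ?E (D ?m) - ?E (D \<mu>)"
      unfolding H_def[abs_def]
      by (intro Bochner_Integration.integral_diff integrable_D m P p_moment)
    then show ?thesis by (simp add: H_def diff_divide_distrib)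
  qed
  finally have "\<bar>remainder N i x\<bar> = \<bar>H (x i) - ?E H\<bar> / N" by simp
  also have "\<dots> \<le> (C / N * (4 + 2 * w (x i) + w (x i) + M0 + 2 * B) + C / N * (4 + 3 * M0 + w (x i) + 2 * B)) / N"
    using H_bound[of "x i"] EH by (intro divide_right_mono) auto
  \<comment> \<open>The two brackets add up to
    \<open>8 + 4 * w (x i) + 4 * M0 + 4 * B\<close>.\<close>
  also have "\<dots> = 4 * C / N\<^sup>2 * (2 + w (x i) + M0 + B)"
    using N by (simp add: power2_eq_square field_simps)
  also have "M0 + B = 2 * M0 + (\<Sum>j=1..N. w (x j)) / N" by (simp add: B_def)
  then have "2 + w (x i) + M0 + B = 2 + w (x i) + 2 * M0 + (\<Sum>j=1..N. w (x j)) / N" by simp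
  finally show ?thesis .
qed

end

section \<open>The martingale part\<close>

lemma ennreal_affine:
  assumes "0 \<le> a" "0 \<le> b" "0 \<le> x" "0 \<le> y"
  shows "ennreal (a + b * x + y) = ennreal a + ennreal b * ennreal x + ennreal y"
  using assms by (simp add: ennreal_mult)

context smooth_functional_pmf
begin

definition "D_increment N i x y = D (borel_pmf (\<kappa> N (i - 1) x)) y - D m0 y"

definition "centred_increment N i x y =
  D_increment N i x y - measure_pmf.expectation p (D_increment N i x)"

text \<open>The constant of \<open>D_increment_square_le\<close> with \<open>1 + w\<close>
  integrated against \<open>p\<close>.\<close>

definition "martingale_constant = 12 * C\<^sup>2 * (2 + 2 * M0)\<^sup>2 * (1 + M0)"

lemma martingale_constant_nonneg: "0 \<le> martingale_constant"
  using M0_nonneg by (simp add: martingale_constant_def)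

lemma integrable_D_increment:
  assumes "N \<ge> 1"
  shows "integrable (measure_pmf p) (D_increment N i x)"
    and "integrable (measure_pmf p) (\<lambda>y. (D_increment N i x y)\<^sup>2)"
proof -
  note P = kappa_in_P_space[OF assms, of "i - 1" x] m0_in_P_space
  note D = P[THEN integrable_D, OF p_moment] and D2 = P[THEN integrable_D_square, OF p_moment]
  show "integrable (measure_pmf p) (D_increment N i x)"
    unfolding D_increment_def[abs_def] using D by auto
  show "integrable (measure_pmf p) (\<lambda>y. (D_increment N i x y)\<^sup>2)"
  proof (rule Bochner_Integration.integrable_bound)
    show "integrable (measure_pmf p) (\<lambda>y. 2 * (D (borel_pmf (\<kappa> N (i - 1) x)) y)\<^sup>2 + 2 * (D m0 y)\<^sup>2)"
      using D2 by auto
    have "(a - b)\<^sup>2 \<le> 2 * a\<^sup>2 + 2 * b\<^sup>2" for a b :: real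
      using zero_le_power2[of "a + b"] by (simp add: power2_eq_square algebra_simps)
    then show "AE y in p. norm ((D_increment N i x y)\<^sup>2) \<le>
        norm (2 * (D (borel_pmf (\<kappa> N (i - 1) x)) y)\<^sup>2 + 2 * (D m0 y)\<^sup>2)"
      by (auto simp: D_increment_def intro!: AE_I2)
  qed simp
qed

lemma centred_increment_moments:
  assumes "N \<ge> 1"
  shows "measure_pmf.expectation p (centred_increment N i x) = 0"
    and "integrable (measure_pmf p) (\<lambda>y. (centred_increment N i x y)\<^sup>2)"
    and "measure_pmf.expectation p (\<lambda>y. (centred_increment N i x y)\<^sup>2) \<le>
      measure_pmf.expectation p (\<lambda>y. (D_increment N i x y)\<^sup>2)"
proof -
  note I = integrable_D_increment[OF assms, of i x]
  show "measure_pmf.expectation p (centred_increment N i x) = 0"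
    using I by (simp add: centred_increment_def[abs_def])
  show "integrable (measure_pmf p) (\<lambda>y. (centred_increment N i x y)\<^sup>2)"
    using I by (simp add: centred_increment_def power2_diff)
  show "measure_pmf.expectation p (\<lambda>y. (centred_increment N i x y)\<^sup>2) \<le>
      measure_pmf.expectation p (\<lambda>y. (D_increment N i x y)\<^sup>2)"
    using measure_pmf.variance_eq[OF I] by (simp add: centred_increment_def)
qed

text \<open>Given the first \<open>i - 1\<close> samples, the variance is at most a constant times
  the distance of their partial empirical law from \<open>p\<close>; averaging that distance gives a
  bound free of \<open>i\<close>.\<close>

lemma nn_integral_centred_increment:
  assumes N: "N \<ge> 1" and i: "1 \<le> i" "i \<le> N"
  shows "(\<integral>\<^sup>+x. (\<integral>\<^sup>+y. ennreal ((centred_increment N i x y)\<^sup>2) \<partial>p) \<partial>Pi_pmf {1..<i} d (\<lambda>_. p))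
    \<le> ennreal (martingale_constant * tv_rate w p N)"
proof -
  have I: "{1..<i} = {1..i - 1}" using i by auto
  let ?Q = "Pi_pmf {1..i - 1} d (\<lambda>_. p)"
  let ?tv = "\<lambda>x. weighted_tv w p (\<kappa> N (i - 1) x)"
  have "(\<integral>\<^sup>+y. ennreal ((centred_increment N i x y)\<^sup>2) \<partial>p) \<le> ennreal martingale_constant * ennreal (?tv x)"
    if "x \<in> set_pmf ?Q" for x
  proof -
    have supp: "set_pmf (\<kappa> N (i - 1) x) \<subseteq> set_pmf p"
      using that by (intro set_partial_empirical N) (auto simp: set_Pi_pmf PiE_dflt_def)
    have t: "0 \<le> ?tv x" by (rule weighted_tv_nonneg[OF supp _ p_moment kappa_moment[OF N]]) simp
    have "(\<integral>\<^sup>+y. ennreal ((centred_increment N i x y)\<^sup>2) \<partial>p) =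
        ennreal (measure_pmf.expectation p (\<lambda>y. (centred_increment N i x y)\<^sup>2))"
      using centred_increment_moments[OF N] by (intro nn_integral_eq_integral) auto
    also have "\<dots> \<le> ennreal (measure_pmf.expectation p (\<lambda>y. (D_increment N i x y)\<^sup>2))"
      by (intro ennreal_leI centred_increment_moments N)
    also have "\<dots> \<le> ennreal (measure_pmf.expectation p (\<lambda>y. 12 * C\<^sup>2 * (2 + 2 * M0)\<^sup>2 * (1 + w y) * ?tv x))"
      using p_moment integrable_D_increment[OF N] D_increment_square_le[OF supp kappa_moment[OF N]]
      by (intro ennreal_leI integral_mono) (auto simp: D_increment_def)
    also have "\<dots> = ennreal (martingale_constant * ?tv x)"
      using p_moment by (simp add: martingale_constant_def)
    also have "\<dots> = ennreal martingale_constant * ennreal (?tv x)"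
      using martingale_constant_nonneg t by (simp add: ennreal_mult)
    finally show ?thesis .
  qed
  then have "(\<integral>\<^sup>+x. (\<integral>\<^sup>+y. ennreal ((centred_increment N i x y)\<^sup>2) \<partial>p) \<partial>?Q) \<le>
      (\<integral>\<^sup>+x. ennreal martingale_constant * ennreal (?tv x) \<partial>?Q)"
    by (intro nn_integral_mono_AE) (auto simp: AE_measure_pmf_iff)
  also have "\<dots> = ennreal martingale_constant * (\<integral>\<^sup>+x. ennreal (?tv x) \<partial>?Q)"
    by (simp add: nn_integral_cmult)
  also have "\<dots> \<le> ennreal martingale_constant * ennreal (tv_rate w p N)"
    using i by (intro mult_left_mono nn_integral_weighted_tv_partial_empirical N p_moment) auto
  also have "\<dots> = ennreal (martingale_constant * tv_rate w p N)"
    using martingale_constant_nonneg tv_rate_nonneg[of w p N] by (simp add: ennreal_mult)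
  finally show ?thesis unfolding I .
qed

text \<open>Orthogonality turns the square of the sum into \<open>N\<close> variances with one
  common vanishing bound, and the normalisation divides by \<open>N\<close>.\<close>

lemma nn_integral_centred_increment_sum:
  assumes N: "N \<ge> 1"
  shows "(\<integral>\<^sup>+x. ennreal \<bar>(\<Sum>i=1..N. centred_increment N i x (x i)) / sqrt (real N)\<bar> \<partial>Pi_pmf {1..N} d (\<lambda>_. p))
    \<le> ennreal (sqrt (martingale_constant * tv_rate w p N))"
proof (rule measure_pmf.nn_integral_abs_le_sqrt)
  let ?Q = "Pi_pmf {1..N} d (\<lambda>_. p)" and ?S = "\<lambda>x. \<Sum>i=1..N. centred_increment N i x (x i)"
  have "(\<integral>\<^sup>+x. ennreal ((?S x / sqrt (real N))\<^sup>2) \<partial>?Q) = ennreal (1 / real N) * (\<integral>\<^sup>+x. ennreal ((?S x)\<^sup>2) \<partial>?Q)"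
    by (rule nn_integral_square_divide_sqrt)
  also have "(\<integral>\<^sup>+x. ennreal ((?S x)\<^sup>2) \<partial>?Q) =
      (\<Sum>i=1..N. \<integral>\<^sup>+x. (\<integral>\<^sup>+y. ennreal ((centred_increment N i x y)\<^sup>2) \<partial>p) \<partial>Pi_pmf {1..<i} d (\<lambda>_. p))"
  proof (rule nn_integral_martingale_square)
    show "centred_increment N i x = centred_increment N i x'"
      if "\<And>j. j \<in> {1..<i} \<Longrightarrow> x j = x' j" for i x x'
    proof -
      have "\<kappa> N (i - 1) x = \<kappa> N (i - 1) x'"
        using that by (intro partial_empirical_cong N) auto
      then show ?thesis by (simp add: centred_increment_def[abs_def] D_increment_def[abs_def])
    qed
  qed (use centred_increment_moments[OF N] in auto)
  also have "ennreal (1 / real N) * \<dots> \<le> ennreal (1 / real N) * (\<Sum>i=1..N. ennreal (martingale_constant * tv_rate w p N))"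
    by (intro mult_left_mono sum_mono nn_integral_centred_increment N) auto
  also have "\<dots> = ennreal (martingale_constant * tv_rate w p N)"
    using N martingale_constant_nonneg tv_rate_nonneg[of w p N]
    by (simp add: ennreal_of_nat_eq_real_of_nat flip: ennreal_mult)
  finally show "(\<integral>\<^sup>+x. ennreal ((?S x / sqrt (real N))\<^sup>2) \<partial>?Q) \<le> ennreal (martingale_constant * tv_rate w p N)" .
qed simp

text \<open>There are \<open>N\<close> remainders of order \<open>1 / N\<^sup>2\<close>, so the
  factor \<open>sqrt N\<close> leaves order \<open>1 / sqrt N\<close>, for every single
  sample.\<close>

lemma sqrt_sum_remainder_le:
  assumes N: "N \<ge> 1"
  shows "sqrt (real N) * (\<Sum>i=1..N. \<bar>remainder N i x\<bar>) \<le> 8 * C / sqrt (real N) * (1 + M0 + (\<Sum>j=1..N. w (x j)) / N)"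
proof -
  let ?W = "\<Sum>j=1..N. w (x j)"
  have "(\<Sum>i=1..N. \<bar>remainder N i x\<bar>) \<le> (\<Sum>i=1..N. 4 * C / N\<^sup>2 * (2 + w (x i) + 2 * M0 + ?W / N))"
    by (intro sum_mono remainder_le) auto
  also have "\<dots> = 4 * C / N\<^sup>2 * (N * 2 + ?W + N * (2 * M0) + N * (?W / N))"
    unfolding sum_distrib_left[symmetric] sum.distrib by simp
  also have "\<dots> = 8 * C / N * (1 + M0 + ?W / N)"
    using N by (simp add: power2_eq_square field_simps)
  finally have "sqrt (real N) * (\<Sum>i=1..N. \<bar>remainder N i x\<bar>) \<le> sqrt (real N) * (8 * C / N * (1 + M0 + ?W / N))"
    by (intro mult_left_mono) auto
  also have "\<dots> = (sqrt (real N) / N) * (8 * C * (1 + M0 + ?W / N))" by simp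
  also have "sqrt (real N) / N = 1 / sqrt (real N)" by (simp add: sqrt_divide_self_eq inverse_eq_divide)
  finally show ?thesis by simp
qed

section \<open>Linearisation error of the normalised fluctuation in mean\<close>

definition "clt_error_bound N =
  8 * C / sqrt (real N) * (1 + 2 * M0) + sqrt (martingale_constant * tv_rate w p N)"

lemma clt_error_bound_nonneg: "0 \<le> clt_error_bound N"
  using C_nonneg M0_nonneg martingale_constant_nonneg tv_rate_nonneg[of w p N]
  by (simp add: clt_error_bound_def)

lemma clt_error_bound_tendsto_0: "clt_error_bound \<longlonglongrightarrow> 0"
proof -
  have 1: "(\<lambda>N. 8 * C / sqrt (real N) * (1 + 2 * M0)) \<longlonglongrightarrow> 0 * (1 + 2 * M0)"
    by (intro tendsto_mult tendsto_const tendsto_divide_0[OF tendsto_const] filterlim_at_top_imp_at_infinity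
        filterlim_compose[OF sqrt_at_top] filterlim_real_sequentially)
  have 2: "(\<lambda>N. sqrt (martingale_constant * tv_rate w p N)) \<longlonglongrightarrow> sqrt (martingale_constant * 0)"
    by (intro tendsto_intros tv_rate_tendsto_0 p_moment) auto
  from tendsto_add[OF 1 2] show ?thesis
    by (simp add: clt_error_bound_def[abs_def])
qed

text \<open>The increments telescope. \<open>centred_increment\<close> is the excess of the centred
  derivative at the current measure over that at \<open>m0\<close>, so the first two sums recombine
  to the linear terms of the steps.\<close>

lemma U_expansion:
  assumes N: "N \<ge> 1"
  shows "sqrt (real N) * (U (borel_pmf (\<kappa> N N x)) - U m0) =
    (\<Sum>i=1..N. D m0 (x i) - measure_pmf.expectation p (D m0)) / sqrt (real N) +
    (\<Sum>i=1..N. centred_increment N i x (x i)) / sqrt (real N) + sqrt (real N) * (\<Sum>i=1..N. remainder N i x)"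
proof -
  let ?E = "measure_pmf.expectation p"
  have tel: "(\<Sum>i=1..n. F i - F (i - 1)) = F n - F 0" for F :: "nat \<Rightarrow> real" and n
    by (induction n) auto
  have E: "?E (D_increment N i x) = ?E (D (borel_pmf (\<kappa> N (i - 1) x))) - ?E (D m0)" for i
    unfolding D_increment_def[abs_def]
    by (intro Bochner_Integration.integral_diff integrable_D kappa_in_P_space N m0_in_P_space p_moment)
  have "U (borel_pmf (\<kappa> N N x)) - U m0 = (\<Sum>i=1..N. U (borel_pmf (\<kappa> N i x)) - U (borel_pmf (\<kappa> N (i - 1) x)))"
    using tel[of "\<lambda>i. U (borel_pmf (\<kappa> N i x))" N] by (simp add: partial_empirical_0[OF N])
  also have "\<dots> = (\<Sum>i=1..N. (D m0 (x i) - ?E (D m0)) / N + centred_increment N i x (x i) / N + remainder N i x)"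
    unfolding add_divide_distrib[symmetric]
    by (intro sum.cong refl) (simp add: remainder_def centred_increment_def E D_increment_def)
  also have "\<dots> = (\<Sum>i=1..N. D m0 (x i) - ?E (D m0)) / N + (\<Sum>i=1..N. centred_increment N i x (x i)) / N +
      (\<Sum>i=1..N. remainder N i x)"
    by (simp only: sum.distrib sum_divide_distrib)
  finally have "sqrt (real N) * (U (borel_pmf (\<kappa> N N x)) - U m0) =
      (sqrt (real N) / N) * (\<Sum>i=1..N. D m0 (x i) - ?E (D m0)) + (sqrt (real N) / N) * (\<Sum>i=1..N. centred_increment N i x (x i)) +
      sqrt (real N) * (\<Sum>i=1..N. remainder N i x)"
    by (simp add: distrib_left)
  also have "sqrt (real N) / N = 1 / sqrt (real N)" by (simp add: sqrt_divide_self_eq inverse_eq_divide)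
  finally show ?thesis by simp
qed

lemma nn_integral_clt_error:
  assumes N: "N \<ge> 1"
  shows "(\<integral>\<^sup>+x. ennreal \<bar>sqrt (real N) * (U (borel_pmf (\<kappa> N N x)) - U m0) -
      (\<Sum>i=1..N. D m0 (x i) - measure_pmf.expectation p (D m0)) / sqrt (real N)\<bar> \<partial>Pi_pmf {1..N} d (\<lambda>_. p))
    \<le> ennreal (clt_error_bound N)"
proof -
  let ?Q = "Pi_pmf {1..N} d (\<lambda>_. p)"
  let ?S = "\<lambda>x. (\<Sum>i=1..N. centred_increment N i x (x i)) / sqrt (real N)"
  let ?c = "8 * C / sqrt (real N)"
  have c: "0 \<le> ?c" using C_nonneg by simp
  have wi: "(\<integral>\<^sup>+x. ennreal (w (x j)) \<partial>?Q) = ennreal M0" if "j \<in> {1..N}" for j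
  proof -
    have "(\<integral>\<^sup>+x. ennreal (w (x j)) \<partial>?Q) = (\<integral>\<^sup>+y. ennreal (w y) \<partial>map_pmf (\<lambda>x. x j) ?Q)" by simp
    also have "map_pmf (\<lambda>x. x j) ?Q = p" using that by (simp add: Pi_pmf_component)
    also have "(\<integral>\<^sup>+y. ennreal (w y) \<partial>p) = ennreal M0"
      using p_moment by (intro nn_integral_eq_integral) auto
    finally show ?thesis .
  qed
  have "(\<integral>\<^sup>+x. ennreal \<bar>sqrt (real N) * (U (borel_pmf (\<kappa> N N x)) - U m0) -
        (\<Sum>i=1..N. D m0 (x i) - measure_pmf.expectation p (D m0)) / sqrt (real N)\<bar> \<partial>?Q) \<le>
      (\<integral>\<^sup>+x. (ennreal (?c * (1 + M0)) + ennreal (?c / N) * (\<Sum>j=1..N. ennreal (w (x j)))) + ennreal \<bar>?S x\<bar> \<partial>?Q)"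
  proof (intro nn_integral_mono)
    fix x
    let ?W = "\<Sum>j=1..N. w (x j)"
    have W: "0 \<le> ?W" by (intro sum_nonneg) auto
    have "\<bar>sqrt (real N) * (\<Sum>i=1..N. remainder N i x)\<bar> \<le> sqrt (real N) * (\<Sum>i=1..N. \<bar>remainder N i x\<bar>)"
      unfolding abs_mult by (simp add: mult_left_mono sum_abs)
    also have "\<dots> \<le> ?c * (1 + M0 + ?W / N)" by (rule sqrt_sum_remainder_le[OF N])
    also have "\<dots> = ?c * (1 + M0) + ?c / N * ?W" by (simp only: distrib_left) simp
    finally have "\<bar>sqrt (real N) * (U (borel_pmf (\<kappa> N N x)) - U m0) -
        (\<Sum>i=1..N. D m0 (x i) - measure_pmf.expectation p (D m0)) / sqrt (real N)\<bar> \<le> (?c * (1 + M0) + ?c / N * ?W) + \<bar>?S x\<bar>"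
      unfolding U_expansion[OF N] by linarith
    then have "ennreal \<bar>sqrt (real N) * (U (borel_pmf (\<kappa> N N x)) - U m0) -
        (\<Sum>i=1..N. D m0 (x i) - measure_pmf.expectation p (D m0)) / sqrt (real N)\<bar> \<le>
        ennreal ((?c * (1 + M0) + ?c / N * ?W) + \<bar>?S x\<bar>)"
      by (rule ennreal_leI)
    also have "\<dots> = (ennreal (?c * (1 + M0)) + ennreal (?c / N) * ennreal ?W) + ennreal \<bar>?S x\<bar>"
    proof -
      have "0 \<le> ?c * (1 + M0)" by (rule mult_nonneg_nonneg[OF c]) (use M0_nonneg in simp)
      moreover have "0 \<le> ?c / N" by (rule divide_nonneg_nonneg[OF c]) simp
      ultimately show ?thesis using W by (intro ennreal_affine) auto
    qed
    also have "ennreal ?W = (\<Sum>j=1..N. ennreal (w (x j)))" by (subst sum_ennreal) auto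
    finally show "ennreal \<bar>sqrt (real N) * (U (borel_pmf (\<kappa> N N x)) - U m0) -
        (\<Sum>i=1..N. D m0 (x i) - measure_pmf.expectation p (D m0)) / sqrt (real N)\<bar> \<le>
        (ennreal (?c * (1 + M0)) + ennreal (?c / N) * (\<Sum>j=1..N. ennreal (w (x j)))) + ennreal \<bar>?S x\<bar>" .
  qed
  also have "\<dots> = (ennreal (?c * (1 + M0)) + ennreal (?c / N) * (\<Sum>j=1..N. \<integral>\<^sup>+x. ennreal (w (x j)) \<partial>?Q)) +
      (\<integral>\<^sup>+x. ennreal \<bar>?S x\<bar> \<partial>?Q)"
    by (simp add: nn_integral_add nn_integral_cmult nn_integral_sum del: sum_ennreal)
  also have "\<dots> \<le> (ennreal (?c * (1 + M0)) + ennreal (?c / N) * (\<Sum>j=1..N. ennreal M0)) +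
      ennreal (sqrt (martingale_constant * tv_rate w p N))"
    using wi by (intro add_mono mult_left_mono nn_integral_centred_increment_sum N) auto
  also have "(\<Sum>j=1..N. ennreal M0) = ennreal (N * M0)"
    using M0_nonneg by (simp add: ennreal_mult ennreal_of_nat_eq_real_of_nat)
  also have "(ennreal (?c * (1 + M0)) + ennreal (?c / N) * ennreal (N * M0)) +
      ennreal (sqrt (martingale_constant * tv_rate w p N)) =
      ennreal (?c * (1 + M0) + ?c / N * (N * M0) + sqrt (martingale_constant * tv_rate w p N))"
  proof -
    have "0 \<le> ?c * (1 + M0)" by (rule mult_nonneg_nonneg[OF c]) (use M0_nonneg in simp)
    moreover have "0 \<le> ?c / N" by (rule divide_nonneg_nonneg[OF c]) simp
    moreover have "0 \<le> N * M0" "0 \<le> sqrt (martingale_constant * tv_rate w p N)"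
      using M0_nonneg martingale_constant_nonneg tv_rate_nonneg[of w p N] by simp_all
    ultimately show ?thesis by (intro ennreal_affine[symmetric])
  qed
  also have "?c * (1 + M0) + ?c / N * (N * M0) = ?c * (1 + M0) + ?c * M0"
    using N by simp
  \<comment> \<open>One \<open>M0\<close> is the moment of \<open>p\<close>, the other the mean of
    the empirical moment.\<close>
  also have "\<dots> = ?c * (1 + 2 * M0)"
    by (simp only: distrib_left[symmetric]) simp
  also have "?c * (1 + 2 * M0) + sqrt (martingale_constant * tv_rate w p N) = clt_error_bound N"
    by (simp add: clt_error_bound_def)
  finally show ?thesis .
qed

end

section \<open>Weak convergence and laws of discrete samples\<close>

text \<open>A \<open>pmf\<close> charges almost every point. The points of \<open>S\<close> without
  mass are countably many, so together they form a null set.\<close>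

lemma (in prob_space) pmf_of_countable_range:
  assumes S: "countable S" and X [measurable]: "X \<in> measurable M (count_space S)"
  obtains q where "X \<in> measurable M (count_space UNIV)" "distr M (count_space UNIV) X = measure_pmf q"
    "\<And>x. pmf q x = prob (X -` {x} \<inter> space M)"
proof -
  have XU [measurable]: "X \<in> measurable M (count_space UNIV)"
    by (rule measurable_compose[OF X]) simp
  let ?D = "distr M (count_space UNIV) X"
  interpret D: prob_space ?D by (rule prob_space_distr) simp
  have "AE x in ?D. x \<in> S"
    using measurable_space[OF X] by (simp add: AE_distr_iff)
  moreover have "AE x in ?D. \<forall>y\<in>S. x = y \<longrightarrow> measure ?D {y} \<noteq> 0"
  proof (subst AE_ball_countable[OF S], intro ballI)
    fix y
    show "AE x in ?D. x = y \<longrightarrow> measure ?D {y} \<noteq> 0"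
    proof (cases "measure ?D {y} = 0")
      case True
      then have "{y} \<in> null_sets ?D" by (simp add: null_sets_def D.emeasure_eq_measure)
      from AE_not_in[OF this] show ?thesis by eventually_elim auto
    qed auto
  qed
  ultimately have "AE x in ?D. measure ?D {x} \<noteq> 0" by eventually_elim auto
  then have q: "measure_pmf (Abs_pmf ?D) = ?D"
    by (intro Abs_pmf_inverse) (auto simp: D.prob_space_axioms)
  moreover have "pmf (Abs_pmf ?D) x = prob (X -` {x} \<inter> space M)" for x
    by (simp add: pmf.rep_eq q measure_distr)
  ultimately show thesis using XU by (intro that[of "Abs_pmf ?D"]) auto
qed

text \<open>Only countably many sample vectors occur, and the preimage of each is a finite
  intersection to which independence applies. Coordinates outside \<open>A\<close> are set to
  \<open>d\<close>, the convention of \<open>Pi_pmf\<close>.\<close>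

lemma (in prob_space) distr_eq_Pi_pmf:
  fixes Z :: "'i \<Rightarrow> 'a \<Rightarrow> 'b" and p :: "'i \<Rightarrow> 'b pmf"
  defines "T \<equiv> \<lambda>A d \<omega> i. if i \<in> A then Z i \<omega> else d"
  assumes A: "finite A" "A \<noteq> {}" and S: "countable S" and Z: "indep_vars (\<lambda>_. count_space S) Z A"
    and p: "\<And>i. i \<in> A \<Longrightarrow> distr M (count_space UNIV) (Z i) = measure_pmf (p i)"
  shows "T A d \<in> measurable M (count_space UNIV)"
    and "distr M (count_space UNIV) (T A d) = measure_pmf (Pi_pmf A d p)"
proof -
  have Zm: "Z i \<in> measurable M (count_space S)" if "i \<in> A" for i
    using Z that by (auto simp: indep_vars_def)
  then have ZU: "Z i \<in> measurable M (count_space UNIV)" if "i \<in> A" for i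
    using that by (intro measurable_compose[OF Zm]) auto
  have TS: "Z i \<omega> \<in> S" if "i \<in> A" "\<omega> \<in> space M" for i \<omega>
    using measurable_space[OF Zm[OF that(1)] that(2)] by simp
  let ?R = "PiE_dflt A d (\<lambda>_. S)"
  have pre: "T A d -` {f} \<inter> space M = (\<Inter>i\<in>A. Z i -` ({f i} \<inter> S) \<inter> space M)"
    if "\<And>i. i \<notin> A \<Longrightarrow> f i = d" for f
    using that A TS by (auto simp: T_def fun_eq_iff split: if_splits)
  have R: "countable ?R"
    unfolding dflt_image_PiE[symmetric] using A S by (intro countable_image countable_PiE) auto
  have "T A d \<in> measurable M (count_space ?R)"
    unfolding measurable_count_space_eq_countable[OF R]
  proof (intro conjI ballI)
    show "T A d \<in> space M \<rightarrow> ?R" using TS by (auto simp: T_def PiE_dflt_def)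
    fix f assume "f \<in> ?R"
    then have "T A d -` {f} \<inter> space M = (\<Inter>i\<in>A. Z i -` ({f i} \<inter> S) \<inter> space M)"
      by (intro pre) (auto simp: PiE_dflt_def)
    also have "\<dots> \<in> sets M"
      using A Zm by (intro sets.finite_INT measurable_sets[OF Zm]) auto
    finally show "T A d -` {f} \<inter> space M \<in> sets M" .
  qed
  from pmf_of_countable_range[OF R this] obtain q
    where q: "T A d \<in> measurable M (count_space UNIV)" "distr M (count_space UNIV) (T A d) = measure_pmf q"
      "\<And>f. pmf q f = prob (T A d -` {f} \<inter> space M)" by metis
  show "T A d \<in> measurable M (count_space UNIV)" by fact
  have "q = Pi_pmf A d p"
  proof (rule pmf_eqI)
    fix f
    show "pmf q f = pmf (Pi_pmf A d p) f"
    proof (cases "\<forall>i. i \<notin> A \<longrightarrow> f i = d")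
      case True
      have "pmf q f = prob (\<Inter>i\<in>A. Z i -` ({f i} \<inter> S) \<inter> space M)"
        using True by (simp add: q pre)
      also have "\<dots> = (\<Prod>i\<in>A. prob (Z i -` ({f i} \<inter> S) \<inter> space M))"
        using A by (intro indep_varsD[OF Z]) auto
      also have "\<dots> = (\<Prod>i\<in>A. pmf (p i) (f i))"
      proof (intro prod.cong refl)
        fix i assume i: "i \<in> A"
        have "pmf (p i) (f i) = measure (distr M (count_space UNIV) (Z i)) {f i}"
          using i by (simp add: p measure_pmf_single)
        also have "\<dots> = prob (Z i -` {f i} \<inter> space M)"
          using ZU[OF i] by (simp add: measure_distr)
        also have "Z i -` {f i} \<inter> space M = Z i -` ({f i} \<inter> S) \<inter> space M" using TS[OF i] by auto
        finally show "prob (Z i -` ({f i} \<inter> S) \<inter> space M) = pmf (p i) (f i)" by simp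
      qed
      finally show ?thesis using True A by (simp add: pmf_Pi)
    next
      case False
      then have "T A d -` {f} \<inter> space M = {}" by (auto simp: T_def)
      then have "pmf q f = 0" by (simp add: q(3))
      moreover have "pmf (Pi_pmf A d p) f = 0" using False A by (intro pmf_Pi_outside) auto
      ultimately show ?thesis by simp
    qed
  qed
  with q show "distr M (count_space UNIV) (T A d) = measure_pmf (Pi_pmf A d p)" by simp
qed

text \<open>On the exceptional null set \<open>f\<close> may be anything, since all subsets of that
  set are measurable in the completion.\<close>

lemma measurable_completion_AE_cong:
  assumes h: "h \<in> measurable M N" and eq: "AE \<omega> in M. f \<omega> = h \<omega>" and f: "f \<in> space M \<rightarrow> space N"
  shows "f \<in> measurable (completion M) N"
proof (rule measurableI)
  fix B assume B: "B \<in> sets N"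
  obtain Z where Z: "Z \<in> null_sets M" "{\<omega> \<in> space M. f \<omega> \<noteq> h \<omega>} \<subseteq> Z"
    using eq by (auto simp: eventually_ae_filter)
  have "f -` B \<inter> space M = (h -` B \<inter> space M - Z) \<union> (f -` B \<inter> space M \<inter> Z)"
    using Z(2) by auto
  moreover have "h -` B \<inter> space M - Z \<in> sets (completion M)"
    using measurable_sets[OF h B] Z by auto
  moreover have "f -` B \<inter> space M \<inter> Z \<in> sets (completion M)"
    by (rule null_sets_completion[OF Z(1)]) auto
  ultimately have "f -` B \<inter> space M \<in> sets (completion M)" by (metis sets.Un)
  then show "f -` B \<inter> space (completion M) \<in> sets (completion M)" by simp
qed (use f in auto)

section \<open>Weak convergence by characteristic functions, and normal limits\<close>

lemma norm_iexp_diff_le: "norm (iexp a - iexp b) \<le> \<bar>a - b\<bar>"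
proof -
  have "iexp a - iexp b = iexp b * (iexp (a - b) - 1)"
    by (simp add: right_diff_distrib exp_add[symmetric] algebra_simps)
  then have "norm (iexp a - iexp b) = norm (iexp (a - b) - 1)"
    by (simp add: norm_mult)
  also have "\<dots> = 2 * \<bar>sin ((a - b) / 2)\<bar>" by (rule dist_exp_i_1)
  also have "\<dots> \<le> 2 * \<bar>(a - b) / 2\<bar>" by (intro mult_left_mono abs_sin_x_le_abs_x) auto
  finally show ?thesis by simp
qed

lemma (in prob_space) char_distr_diff_le:
  assumes [measurable]: "X \<in> borel_measurable M" "Y \<in> borel_measurable M"
    and e: "0 \<le> e" "(\<integral>\<^sup>+\<omega>. ennreal \<bar>X \<omega> - Y \<omega>\<bar> \<partial>M) \<le> ennreal e"
  shows "norm (char (distr M borel X) t - char (distr M borel Y) t) \<le> \<bar>t\<bar> * e"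
proof -
  have i: "integrable M (\<lambda>\<omega>. X \<omega> - Y \<omega>)"
    using order.strict_trans1[OF e(2)] by (intro integrableI_bounded) auto
  have ii: "integrable M (\<lambda>\<omega>. iexp (t * Z \<omega>))" if [measurable]: "Z \<in> borel_measurable M" for Z
    by (rule integrable_const_bound[where B=1]) auto
  have "char (distr M borel X) t - char (distr M borel Y) t = (CLINT \<omega>|M. iexp (t * X \<omega>) - iexp (t * Y \<omega>))"
    using ii[of X] ii[of Y] by (simp add: char_def integral_distr)
  also have "norm \<dots> \<le> (\<integral>\<omega>. norm (iexp (t * X \<omega>) - iexp (t * Y \<omega>)) \<partial>M)"
    by (rule integral_norm_bound)
  also have "\<dots> \<le> (\<integral>\<omega>. \<bar>t\<bar> * \<bar>X \<omega> - Y \<omega>\<bar> \<partial>M)"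
  proof (intro integral_mono)
    show "norm (iexp (t * X \<omega>) - iexp (t * Y \<omega>)) \<le> \<bar>t\<bar> * \<bar>X \<omega> - Y \<omega>\<bar>" for \<omega>
      using norm_iexp_diff_le[of "t * X \<omega>" "t * Y \<omega>"] by (simp add: abs_mult right_diff_distrib[symmetric])
  qed (use i ii[of X] ii[of Y] in \<open>auto intro!: integrable_norm\<close>)
  also have "\<dots> = \<bar>t\<bar> * (\<integral>\<omega>. \<bar>X \<omega> - Y \<omega>\<bar> \<partial>M)" by simp
  also have "\<dots> \<le> \<bar>t\<bar> * e"
    using e i by (intro mult_left_mono) (auto simp: nn_integral_eq_integral)
  finally show ?thesis .
qed

text \<open>Because \<open>iexp\<close> is 1-Lipschitz, the characteristic functions at
  \<open>t\<close> differ by at most \<open>\<bar>t\<bar> * e n\<close>; Levy's continuity theorem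
  then transfers the limit.\<close>

lemma (in prob_space) weak_conv_m_L1_perturbation:
  assumes [measurable]: "\<And>n. X n \<in> borel_measurable M" "\<And>n. Y n \<in> borel_measurable M"
    and conv: "weak_conv_m (\<lambda>n. distr M borel (Y n)) L" and L: "real_distribution L"
    and e: "\<And>n. 0 \<le> e n" "\<And>n. (\<integral>\<^sup>+\<omega>. ennreal \<bar>X n \<omega> - Y n \<omega>\<bar> \<partial>M) \<le> ennreal (e n)" "e \<longlonglongrightarrow> 0"
  shows "weak_conv_m (\<lambda>n. distr M borel (X n)) L"
proof (rule levy_continuity)
  show "real_distribution (distr M borel (X n))" for n by simp
  show "real_distribution L" by fact
  fix t
  have Y: "(\<lambda>n. char (distr M borel (Y n)) t) \<longlonglongrightarrow> char L t"
    by (rule levy_continuity1[OF _ L conv]) simp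
  have "(\<lambda>n. \<bar>t\<bar> * e n) \<longlonglongrightarrow> 0"
    using tendsto_mult[OF tendsto_const e(3), of "\<bar>t\<bar>"] by simp
  then have "(\<lambda>n. char (distr M borel (X n)) t - char (distr M borel (Y n)) t) \<longlonglongrightarrow> 0"
    by (rule Lim_null_comparison[rotated]) (auto intro!: always_eventually char_distr_diff_le e)
  from tendsto_add[OF this Y] show "(\<lambda>n. char (distr M borel (X n)) t) \<longlonglongrightarrow> char L t" by simp
qed

lemma normal_law_eq_distr:
  assumes "0 < v"
  shows "normal_law 0 v = distr std_normal_distribution borel (\<lambda>x. sqrt v * x)"
proof -
  interpret prob_space std_normal_distribution using prob_space_normal_density by simp
  have "distributed std_normal_distribution lborel (\<lambda>x. x) std_normal_density"
    by (auto simp: distributed_def distr_id2 cong: distr_cong)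
  from normal_density_affine[OF this, of "sqrt v" 0] assms
  have "distr std_normal_distribution lborel (\<lambda>x. sqrt v * x) = density lborel (normal_density 0 (sqrt v))"
    by (simp add: distributed_def)
  moreover have "distr std_normal_distribution lborel (\<lambda>x. sqrt v * x) = distr std_normal_distribution borel (\<lambda>x. sqrt v * x)"
    by (rule distr_cong) auto
  ultimately show ?thesis using assms by (simp add: normal_law_def)
qed

lemma real_distribution_normal_law:
  assumes "0 \<le> v"
  shows "real_distribution (normal_law 0 v)"
proof (cases "v = 0")
  case True
  then show ?thesis
    by (auto simp: normal_law_def real_distribution_def real_distribution_axioms_def intro: prob_space_return)
next
  case False
  then show ?thesis
    using assms prob_space_normal_density[of "sqrt v" 0]
    by (auto simp: normal_law_def real_distribution_def real_distribution_axioms_def)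
qed

text \<open>\<open>central_limit_theorem\<close> standardises by a positive deviation. If the
  variance is 0, the sums vanish almost surely and every law is a Dirac mass; otherwise the
  standardisation is undone by evaluating characteristic functions at \<open>t\<close> times the
  deviation.\<close>

lemma (in prob_space) central_limit_theorem_normal_law:
  fixes X :: "nat \<Rightarrow> 'a \<Rightarrow> real"
  assumes indep: "indep_vars (\<lambda>_. borel) X UNIV"
    and distr: "\<And>n. distr M borel (X n) = \<mu>"
    and sq: "integrable M (\<lambda>\<omega>. (X 0 \<omega>)\<^sup>2)"
  shows "weak_conv_m (\<lambda>n. distr M borel (\<lambda>\<omega>. (\<Sum>i<n. X i \<omega> - expectation (X 0)) / sqrt (real n)))
    (normal_law 0 (variance (X 0)))"
proof -
  have [measurable]: "X n \<in> borel_measurable M" for n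
    using indep by (auto simp: indep_vars_def)
  let ?m = "expectation (X 0)" and ?v = "variance (X 0)"
  let ?S = "\<lambda>n \<omega>. \<Sum>i<n. X i \<omega> - ?m"
  have same: "(\<integral>\<omega>. f (X n \<omega>) \<partial>M) = (\<integral>\<omega>. f (X 0 \<omega>) \<partial>M)"
    and same_i: "integrable M (\<lambda>\<omega>. f (X n \<omega>)) \<longleftrightarrow> integrable M (\<lambda>\<omega>. f (X 0 \<omega>))"
    if [measurable]: "f \<in> borel_measurable borel" for f :: "real \<Rightarrow> real" and n
    using integral_distr[of "X n" M borel f] integral_distr[of "X 0" M borel f]
      integrable_distr_eq[of "X n" M borel f] integrable_distr_eq[of "X 0" M borel f]
    by (simp_all add: distr)
  have mean: "expectation (X n) = ?m" for n using same[of "\<lambda>x. x" n] by simp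
  have i: "integrable M (X 0)"
    by (rule square_integrable_imp_integrable[OF _ sq]) simp
  show ?thesis
  proof (cases "?v = 0")
    case True
    have "integrable M (\<lambda>\<omega>. (X 0 \<omega> - ?m)\<^sup>2)" using i sq by (simp add: power2_diff)
    from integral_nonneg_eq_0_iff_AE[OF this] True have "AE \<omega> in M. (X 0 \<omega> - ?m)\<^sup>2 = 0" by simp
    then have "AE \<omega> in M. X 0 \<omega> = ?m" by simp
    \<comment> \<open>The common law carries almost sure constancy from \<open>X 0\<close> to every
      \<open>X n\<close>.\<close>
    then have "AE x in \<mu>. x = ?m"
      unfolding distr[of 0, symmetric] by (simp add: AE_distr_iff)
    then have "AE \<omega> in M. X n \<omega> = ?m" for n
      unfolding distr[of n, symmetric] by (simp add: AE_distr_iff)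
    then have "AE \<omega> in M. \<forall>n. X n \<omega> = ?m" by (simp add: AE_all_countable)
    then have "AE \<omega> in M. ?S n \<omega> / sqrt (real n) = 0" for n by eventually_elim simp
    then have "distr M borel (\<lambda>\<omega>. ?S n \<omega> / sqrt (real n)) = distr M borel (\<lambda>_. 0)" for n
      by (intro distr_cong_AE) auto
    then have "distr M borel (\<lambda>\<omega>. ?S n \<omega> / sqrt (real n)) = return borel 0" for n
      by (simp add: distr_const)
    with True show ?thesis
      by (simp add: normal_law_def weak_conv_m_def weak_conv_def)
  next
    case False
    with variance_positive[of "X 0"] have v: "0 < ?v" by linarith
    have conv: "weak_conv_m (\<lambda>n. distr M borel (\<lambda>\<omega>. ?S n \<omega> / sqrt (n * (sqrt ?v)\<^sup>2))) std_normal_distribution"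
    proof (rule central_limit_theorem[OF indep mean _ _ _ distr])
      show "integrable M (\<lambda>\<omega>. (X n \<omega>)\<^sup>2)" for n
        using same_i[of "\<lambda>x. x\<^sup>2" n] sq by simp
      show "variance (X n) = (sqrt ?v)\<^sup>2" for n
        using same[of "\<lambda>x. (x - ?m)\<^sup>2" n] v by (simp add: mean[of n])
    qed (use v in simp)
    show ?thesis
    proof (rule levy_continuity)
      show "real_distribution (normal_law 0 ?v)" using v by (intro real_distribution_normal_law) simp
      fix t
      have "(\<lambda>n. char (distr M borel (\<lambda>\<omega>. ?S n \<omega> / sqrt (n * (sqrt ?v)\<^sup>2))) (t * sqrt ?v)) \<longlonglongrightarrow>
          char std_normal_distribution (t * sqrt ?v)"
        by (rule levy_continuity1[OF _ real_dist_normal_dist conv]) simp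
      moreover have "char std_normal_distribution (t * sqrt ?v) = char (normal_law 0 ?v) t"
        using v by (simp add: char_def normal_law_eq_distr integral_distr mult_ac)
      moreover have "char (distr M borel (\<lambda>\<omega>. ?S n \<omega> / sqrt (n * (sqrt ?v)\<^sup>2))) (t * sqrt ?v) =
          char (distr M borel (\<lambda>\<omega>. ?S n \<omega> / sqrt n)) t" for n
        using v by (simp add: char_def integral_distr real_sqrt_mult)
      ultimately show "(\<lambda>n. char (distr M borel (\<lambda>\<omega>. ?S n \<omega> / sqrt n)) t) \<longlonglongrightarrow> char (normal_law 0 ?v) t"
        by simp
    qed simp
  qed
qed

text \<open>Serves to shift the samples, indexed from 1, by \<open>Suc\<close> to all natural
  indices.\<close>

lemma (in prob_space) indep_vars_reindex_inj:
  assumes indep: "indep_vars M' X (f ` I)" and f: "inj_on f I"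
  shows "indep_vars (\<lambda>i. M' (f i)) (\<lambda>i. X (f i)) I"
proof -
  have "indep_sets (\<lambda>i. F (f i)) I" if F: "indep_sets F (f ` I)" for F
    unfolding indep_sets_def
  proof (intro conjI ballI allI impI)
    show "F (f i) \<subseteq> events" if "i \<in> I" for i
      using F that by (auto simp: indep_sets_def)
    fix A J assume J: "J \<noteq> {}" "J \<subseteq> I" "finite J" and A: "A \<in> (\<Pi> j\<in>J. F (f j))"
    have fJ: "inj_on f J" using f J by (auto intro: inj_on_subset)
    \<comment> \<open>A family of events over \<open>J\<close> becomes one over its image by
      inverting \<open>f\<close> on \<open>J\<close>.\<close>
    have "prob (\<Inter>j\<in>f ` J. A (the_inv_into J f j)) = (\<Prod>j\<in>f ` J. prob (A (the_inv_into J f j)))"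
      using J A by (intro indep_setsD[OF F]) (auto simp: the_inv_into_f_f[OF fJ])
    then show "prob (\<Inter>j\<in>J. A j) = (\<Prod>j\<in>J. prob (A j))"
      by (simp add: prod.reindex[OF fJ] the_inv_into_f_f[OF fJ])
  qed
  with indep show ?thesis by (auto simp: indep_vars_def2)
qed

section \<open>The central limit theorem\<close>

text \<open>The orthogonality identity for a history-free integrand: the normalised sum has the
  variance of one term. This controls the linear part in mean uniformly in \<open>N\<close>.\<close>

lemma nn_integral_centred_sum_le:
  fixes f :: "'a \<Rightarrow> real"
  assumes f: "integrable (measure_pmf p) (\<lambda>y. (f y)\<^sup>2)" and N: "N \<ge> 1"
  shows "(\<integral>\<^sup>+x. ennreal \<bar>(\<Sum>i=1..N. f (x i) - measure_pmf.expectation p f) / sqrt (real N)\<bar> \<partial>Pi_pmf {1..N} d (\<lambda>_. p))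
    \<le> ennreal (sqrt (measure_pmf.variance p f))"
proof (rule measure_pmf.nn_integral_abs_le_sqrt)
  let ?Q = "Pi_pmf {1..N} d (\<lambda>_. p)" and ?g = "\<lambda>y. f y - measure_pmf.expectation p f"
  have i: "integrable (measure_pmf p) f"
    by (rule finite_measure.square_integrable_imp_integrable) (use f in \<open>auto simp: measure_pmf.finite_measure_axioms\<close>)
  have sq: "integrable (measure_pmf p) (\<lambda>y. (?g y)\<^sup>2)" using i f by (simp add: power2_diff)
  have "(\<integral>\<^sup>+x. ennreal (((\<Sum>i=1..N. ?g (x i)) / sqrt (real N))\<^sup>2) \<partial>?Q) =
      ennreal (1 / real N) * (\<integral>\<^sup>+x. ennreal ((\<Sum>i=1..N. ?g (x i))\<^sup>2) \<partial>?Q)"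
    by (rule nn_integral_square_divide_sqrt)
  also have "(\<integral>\<^sup>+x. ennreal ((\<Sum>i=1..N. ?g (x i))\<^sup>2) \<partial>?Q) =
      (\<Sum>i=1..N. \<integral>\<^sup>+x. (\<integral>\<^sup>+y. ennreal ((?g y)\<^sup>2) \<partial>p) \<partial>Pi_pmf {1..<i} d (\<lambda>_. p))"
    using nn_integral_martingale_square[of "\<lambda>_ _. ?g" p N d] i sq by simp
  also have "(\<integral>\<^sup>+y. ennreal ((?g y)\<^sup>2) \<partial>p) = ennreal (measure_pmf.variance p f)"
    using sq by (intro nn_integral_eq_integral) auto
  also have "ennreal (1 / real N) * (\<Sum>i=1..N. \<integral>\<^sup>+x. ennreal (measure_pmf.variance p f) \<partial>Pi_pmf {1..<i} d (\<lambda>_. p)) =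
      ennreal (measure_pmf.variance p f)"
    using N measure_pmf.variance_positive[of p f] by (simp add: ennreal_of_nat_eq_real_of_nat flip: ennreal_mult)
  finally show "(\<integral>\<^sup>+x. ennreal (((\<Sum>i=1..N. ?g (x i)) / sqrt (real N))\<^sup>2) \<partial>?Q) \<le> ennreal (measure_pmf.variance p f)"
    by simp
qed simp

text \<open>\<open>c\<close> retracts the space onto the countable carrier \<open>S\<close>, sending
  the null complement to some point of \<open>S\<close>. Values then lie in \<open>S\<close>
  everywhere, not just almost everywhere, as measurability into \<open>count_space S\<close>
  demands.\<close>

lemma discrete_measure_conv_pmf:
  fixes m :: "'a::euclidean_space measure"
  assumes "discrete_measure m" "prob_space m" and m [measurable_cong, simp]: "sets m = sets borel"
  obtains S c p where "countable S" "AE x in m. x \<in> S" "\<And>x. x \<in> S \<Longrightarrow> c x = x" "c \<in> measurable borel (count_space S)"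
    "distr m (count_space UNIV) c = measure_pmf p" "m = borel_pmf p"
proof -
  interpret prob_space m by fact
  have [simp]: "space m = UNIV" using sets_eq_imp_space_eq[OF m] by simp
  obtain S where S: "countable S" "AE x in m. x \<in> S"
    using assms(1) by (auto simp: discrete_measure_def)
  have "S \<noteq> {}" using S(2) by auto
  then obtain s0 where s0: "s0 \<in> S" by auto
  have S_sets [measurable]: "S \<in> sets borel"
    by (rule sets.countable[OF _ S(1)]) simp
  define c where "c x = (if x \<in> S then x else s0)" for x
  have c: "c \<in> measurable borel (count_space S)"
    unfolding measurable_count_space_eq_countable[OF S(1)]
  proof (intro conjI ballI)
    show "c \<in> space borel \<rightarrow> S" using s0 by (auto simp: c_def)
    fix a assume "a \<in> S"
    then have "c -` {a} \<inter> space borel = {a} \<union> (if a = s0 then - S else {})"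
      by (auto simp: c_def split: if_splits)
    then show "c -` {a} \<inter> space borel \<in> sets borel" by simp
  qed
  from c have "c \<in> measurable m (count_space S)" by simp
  from pmf_of_countable_range[OF S(1) this] obtain p
    where cm: "c \<in> measurable m (count_space UNIV)" and p: "distr m (count_space UNIV) c = measure_pmf p"
    by metis
  have "borel_pmf p = distr m borel c"
    using cm by (simp add: borel_pmf_def p[symmetric] distr_distr comp_def)
  also have "\<dots> = distr m borel (\<lambda>x. x)"
    using S(2) cm by (intro distr_cong_AE) (auto simp: c_def intro!: measurable_compose[OF cm])
  also have "\<dots> = m" by (rule distr_id2) simp
  finally show thesis using S c p by (intro that[of S c p]) (auto simp: c_def)
qed

text \<open>Replacing each sample by its retraction \<open>c (\<zeta> i \<omega>)\<close> alters the
  vector on a null set only and yields a discrete random vector, of which every function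
  \<open>F\<close> is measurable. The completion absorbs the null set.\<close>

lemma (in prob_space) empirical_transfer:
  fixes F :: "(nat \<Rightarrow> 'b::euclidean_space) \<Rightarrow> real"
  assumes \<zeta>: "indep_vars (\<lambda>_. borel) \<zeta> {1..}" and law: "\<And>i. i \<ge> 1 \<Longrightarrow> distr M borel (\<zeta> i) = m"
    and S: "countable S" "AE x in m. x \<in> S" and c: "\<And>x. x \<in> S \<Longrightarrow> c x = x" "c \<in> measurable borel (count_space S)"
    and p: "distr m (count_space UNIV) c = measure_pmf p" and N: "N \<ge> 1"
    and F: "\<And>x x'. (\<And>i. 1 \<le> i \<Longrightarrow> i \<le> N \<Longrightarrow> x i = x' i) \<Longrightarrow> F x = F x'"
  shows "(\<lambda>\<omega>. F (\<lambda>i. \<zeta> i \<omega>)) \<in> borel_measurable (completion M)"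
    and "(\<integral>\<^sup>+\<omega>. ennreal \<bar>F (\<lambda>i. \<zeta> i \<omega>)\<bar> \<partial>completion M) = (\<integral>\<^sup>+x. ennreal \<bar>F x\<bar> \<partial>Pi_pmf {1..N} 0 (\<lambda>_. p))"
proof -
  have \<zeta>m: "\<zeta> i \<in> borel_measurable M" if "i \<ge> 1" for i
    using \<zeta> that by (auto simp: indep_vars_def)
  have cU: "c \<in> measurable borel (count_space UNIV)"
    by (rule measurable_compose[OF c(2)]) simp
  \<comment> \<open>The value 0 outside \<open>{1..N}\<close> is the default of
    \<open>Pi_pmf\<close>; \<open>F\<close> does not see these coordinates.\<close>
  define T where "T \<omega> i = (if i \<in> {1..N} then c (\<zeta> i \<omega>) else 0)" for \<omega> i
  have indep: "indep_vars (\<lambda>_. count_space S) (\<lambda>i \<omega>. c (\<zeta> i \<omega>)) {1..N}"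
    by (rule indep_vars_compose2[OF indep_vars_subset[OF \<zeta>]]) (use c in auto)
  have law_c: "distr M (count_space UNIV) (\<lambda>\<omega>. c (\<zeta> i \<omega>)) = measure_pmf p" if "i \<in> {1..N}" for i
  proof -
    have "distr M (count_space UNIV) (\<lambda>\<omega>. c (\<zeta> i \<omega>)) = distr (distr M borel (\<zeta> i)) (count_space UNIV) c"
      using \<zeta>m[of i] that by (subst distr_distr[OF cU]) (auto simp: comp_def)
    then show ?thesis using that by (simp add: law p)
  qed
  have T_eq: "T = (\<lambda>\<omega> i. if i \<in> {1..N} then c (\<zeta> i \<omega>) else 0)" by (simp add: T_def fun_eq_iff)
  have "finite {1..N}" "{1..N} \<noteq> {}" using N by auto
  note Pi = distr_eq_Pi_pmf[where Z="\<lambda>i \<omega>. c (\<zeta> i \<omega>)" and p="\<lambda>_. p" and d=0, OF this S(1) indep law_c]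
  have T: "T \<in> measurable M (count_space UNIV)"
    "distr M (count_space UNIV) T = measure_pmf (Pi_pmf {1..N} 0 (\<lambda>_. p))"
    unfolding T_eq by (rule Pi, assumption)+
  have "AE \<omega> in M. \<zeta> i \<omega> \<in> S" if "i \<ge> 1" for i
  proof -
    have "S \<in> sets borel" by (rule sets.countable[OF _ S(1)]) simp
    then show ?thesis
      using S(2) \<zeta>m[OF that] unfolding law[OF that, symmetric] by (simp add: AE_distr_iff)
  qed
  then have "AE \<omega> in M. \<forall>i\<in>{1..N}. \<zeta> i \<omega> \<in> S"
    by (subst AE_ball_countable) auto
  then have eq: "AE \<omega> in M. F (\<lambda>i. \<zeta> i \<omega>) = F (T \<omega>)"
    by eventually_elim (intro F, auto simp: T_def c)
  have FT: "(\<lambda>\<omega>. F (T \<omega>)) \<in> borel_measurable M"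
    by (rule measurable_compose[OF T(1)]) simp
  show "(\<lambda>\<omega>. F (\<lambda>i. \<zeta> i \<omega>)) \<in> borel_measurable (completion M)"
    by (rule measurable_completion_AE_cong[OF FT eq]) simp
  have "(\<integral>\<^sup>+\<omega>. ennreal \<bar>F (\<lambda>i. \<zeta> i \<omega>)\<bar> \<partial>completion M) = (\<integral>\<^sup>+\<omega>. ennreal \<bar>F (T \<omega>)\<bar> \<partial>M)"
  proof -
    have "AE \<omega> in M. ennreal \<bar>F (\<lambda>i. \<zeta> i \<omega>)\<bar> = ennreal \<bar>F (T \<omega>)\<bar>" using eq by eventually_elim simp
    then show ?thesis unfolding nn_integral_completion by (rule nn_integral_cong_AE)
  qed
  also have "\<dots> = (\<integral>\<^sup>+x. ennreal \<bar>F x\<bar> \<partial>distr M (count_space UNIV) T)"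
    using T(1) by (subst nn_integral_distr) auto
  finally show "(\<integral>\<^sup>+\<omega>. ennreal \<bar>F (\<lambda>i. \<zeta> i \<omega>)\<bar> \<partial>completion M) = (\<integral>\<^sup>+x. ennreal \<bar>F x\<bar> \<partial>Pi_pmf {1..N} 0 (\<lambda>_. p))"
    by (simp add: T(2))
qed

lemma S_class_smooth_functional:
  fixes U :: "'a::euclidean_space measure \<Rightarrow> real"
  assumes l: "0 \<le> l" and U: "U \<in> S_class 1 (l / 2) l \<inter> S_class 2 l l"
    and bound: "\<exists>C. \<forall>\<mu>\<in>P_space l. \<forall>x y. \<bar>lfd_n l U 2 \<mu> ((!) [x, y])\<bar> \<le>
           C * (1 + rpow (norm x) (l / 2) + rpow (norm y) l + (\<integral>z. rpow (norm z) l \<partial>\<mu>))"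
  obtains C where "smooth_functional l U (lfd l U) (\<lambda>m x. lfd l (\<lambda>m. lfd l U m x) m) C"
proof -
  have "U \<in> S_class 1 (l / 2) l" "1 \<in> {1..1::nat}" using U by auto
  then have "\<exists>C. \<forall>m\<in>P_space l. \<forall>x. \<bar>lfd_n l U 1 m x\<bar> \<le> C * (1 + (\<Sum>p<1. rpow (norm (x p)) (l / 2)) +
      (if l > 0 then rpow (\<integral>z. rpow (norm z) l \<partial>m) (l / 2 / l) else 0))"
    unfolding S_class_def by blast
  then obtain C1 where C1: "\<bar>lfd_n l U 1 m x\<bar> \<le> C1 * (1 + (\<Sum>p<1. rpow (norm (x p)) (l / 2)) +
      (if l > 0 then rpow (\<integral>z. rpow (norm z) l \<partial>m) (l / 2 / l) else 0))" if "m \<in> P_space l" for m x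
    by blast
  from bound obtain C2 where C2: "\<bar>lfd_n l U 2 m ((!) [x, y])\<bar> \<le>
      C2 * (1 + rpow (norm x) (l / 2) + rpow (norm y) l + (\<integral>z. rpow (norm z) l \<partial>m))" if "m \<in> P_space l" for m x y
    by blast
  \<comment> \<open>The given constants are not known to be nonnegative, hence the maximum with
    0.\<close>
  define C where "C = max 0 (max C1 C2)"
  have M: "0 \<le> (\<integral>z. rpow (norm z) l \<partial>m)" for m :: "'a measure"
    by (intro integral_nonneg_AE) auto
  have "smooth_functional l U (lfd l U) (\<lambda>m x. lfd l (\<lambda>m. lfd l U m x) m) C"
  proof
    fix m :: "'a measure" and x y assume m: "m \<in> P_space l"
    have "admits_lfd_n l U 1 m" using U m by (auto simp: S_class_def)
    then obtain f where "has_lfd l U m f" by auto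
    then show "has_lfd l U m (lfd l U m)" by (rule has_lfd_lfd[OF _ m])
    have "admits_lfd_n l U 2 m" using U m by (auto simp: S_class_def)
    then have "\<forall>x. \<exists>f. has_lfd l (\<lambda>m. lfd l U m (x (0::nat))) m f"
      by (simp add: numeral_2_eq_2)
    \<comment> \<open>Only the entry at index 0 is read, so a constant sequence represents the point
      \<open>x\<close>.\<close>
    from this[rule_format, of "\<lambda>_. x"] obtain f where "has_lfd l (\<lambda>m. lfd l U m x) m f" by auto
    then show "has_lfd l (\<lambda>m. lfd l U m x) m (lfd l (\<lambda>m. lfd l U m x) m)" by (rule has_lfd_lfd[OF _ m])
    \<comment> \<open>The exponent \<open>l / 2 / l\<close> is one half. For \<open>l = 0\<close>
      the class bound has no moment term; the square root added next is nonnegative, so one form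
      covers both cases.\<close>
    have "\<bar>lfd l U m x\<bar> \<le> C1 * (1 + sqrt (rpow (norm x) l) +
        (if l > 0 then sqrt (\<integral>z. rpow (norm z) l \<partial>m) else 0))"
      using C1[OF m, of "\<lambda>_. x"] M[of m] by (simp add: rpow_half rpow_def[of "integral\<^sup>L m _"] powr_half_sqrt split: if_splits)
    also have "\<dots> \<le> C * (1 + sqrt (rpow (norm x) l) + sqrt (\<integral>z. rpow (norm z) l \<partial>m))"
      using M[of m] by (intro mult_mono) (auto simp: C_def)
    finally show "\<bar>lfd l U m x\<bar> \<le> C * (1 + sqrt (rpow (norm x) l) + sqrt (\<integral>z. rpow (norm z) l \<partial>m))" .
    have "\<bar>lfd l (\<lambda>m. lfd l U m x) m y\<bar> \<le> C2 * (1 + sqrt (rpow (norm x) l) + rpow (norm y) l + (\<integral>z. rpow (norm z) l \<partial>m))"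
      using C2[OF m, of x y] by (simp add: numeral_2_eq_2 rpow_half)
    also have "\<dots> \<le> C * (1 + sqrt (rpow (norm x) l) + rpow (norm y) l + (\<integral>z. rpow (norm z) l \<partial>m))"
      using M[of m] by (intro mult_right_mono) (auto simp: C_def)
    finally show "\<bar>lfd l (\<lambda>m. lfd l U m x) m y\<bar> \<le>
        C * (1 + sqrt (rpow (norm x) l) + rpow (norm y) l + (\<integral>z. rpow (norm z) l \<partial>m))" .
  qed (simp add: C_def)
  then show thesis by (rule that)
qed

theorem corollary3p4:
  fixes M :: "'w measure"
    and \<zeta> :: "nat \<Rightarrow> 'w \<Rightarrow> real ^ 'd"
    and m0 :: "(real ^ 'd) measure"
    and U :: "(real ^ 'd) measure \<Rightarrow> real"
    and l :: real
  defines "mN \<equiv> \<lambda>N \<omega>. empirical_measure N (\<lambda>i. \<zeta> i \<omega>)"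
  assumes "l \<ge> 0"
    and "m0 \<in> P_space l" and "discrete_measure m0"
    and "prob_space M"
    and "prob_space.indep_vars M (\<lambda>_. borel) \<zeta> {1..}"
    and "\<And>i. i \<ge> 1 \<Longrightarrow> distr M borel (\<zeta> i) = m0"
    and "U \<in> S_class 1 (l / 2) l \<inter> S_class 2 l l"
    and "\<exists>C. \<forall>\<mu>\<in>P_space l. \<forall>x y. \<bar>lfd_n l U 2 \<mu> ((!) [x, y])\<bar> \<le>
           C * (1 + rpow (norm x) (l / 2) + rpow (norm y) l + (\<integral>z. rpow (norm z) l \<partial>\<mu>))"
  shows "converges_in_distribution M (\<lambda>N \<omega>. sqrt (real N) * (U (mN N \<omega>) - U m0))
           (normal_law 0 (prob_space.variance M (\<lambda>\<omega>. lfd l U m0 (\<zeta> 1 \<omega>))))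
       \<and> (SUP N\<in>{1..}. ennreal (sqrt (real N)) *
            (\<integral>\<^sup>+\<omega>. ennreal \<bar>U (mN N \<omega>) - U m0\<bar> \<partial>completion M)) < \<infinity>"
proof -
  interpret prob_space M by fact
  interpret Mc: prob_space "completion M" by (rule prob_space_completion)
  note indep = assms(6) and law = assms(7)
  obtain S c p where S: "countable S" "AE x in m0. x \<in> S"
    and c: "\<And>x. x \<in> S \<Longrightarrow> c x = x" "c \<in> measurable borel (count_space S)"
    and p: "distr m0 (count_space UNIV) c = measure_pmf p" and m0: "m0 = borel_pmf p"
    using discrete_measure_conv_pmf[OF assms(4) P_space_D(1,2)[OF assms(3)]] by metis
  obtain C where "smooth_functional l U (lfd l U) (\<lambda>m x. lfd l (\<lambda>m. lfd l U m x) m) C"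
    using S_class_smooth_functional[OF assms(2,8,9)] by blast
  then interpret smooth_functional_pmf l U "lfd l U" "\<lambda>m x. lfd l (\<lambda>m. lfd l U m x) m" C p
    using assms(3) by (auto simp: smooth_functional_pmf_def smooth_functional_pmf_axioms_def m0 borel_pmf_in_P_space)
  note transfer = empirical_transfer[OF indep law S c p]

  let ?f = "lfd l U m0"
  let ?Ef = "measure_pmf.expectation p ?f"
  define F where "F N x = sqrt (real N) * (U (borel_pmf (partial_empirical p N N x)) - U m0)" for N x
  define Y where "Y N x = (\<Sum>i=1..N. ?f (x i) - ?Ef) / sqrt (real N)" for N and x :: "nat \<Rightarrow> real ^ 'd"
  have mP: "m0 \<in> P_space l" by fact
  have F_cong: "F N x = F N x'" if "N \<ge> 1" "\<And>i. 1 \<le> i \<Longrightarrow> i \<le> N \<Longrightarrow> x i = x' i" for N x x'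
  proof -
    have "partial_empirical p N N x = partial_empirical p N N x'"
      by (rule partial_empirical_cong[OF that(1)]) (rule that(2))
    then show ?thesis by (simp add: F_def)
  qed
  have Y_cong: "Y N x = Y N x'" if "N \<ge> 1" "\<And>i. 1 \<le> i \<Longrightarrow> i \<le> N \<Longrightarrow> x i = x' i" for N x x'
    unfolding Y_def using that(2) by (auto intro!: sum.cong arg_cong2[where f="(/)"])
  \<comment> \<open>At \<open>N = 0\<close> both sides vanish through the factor
    \<open>sqrt 0\<close>, which lets the limit statements run over all \<open>N\<close>.\<close>
  have X: "sqrt (real N) * (U (mN N \<omega>) - U m0) = F N (\<lambda>i. \<zeta> i \<omega>)" for N \<omega>
    by (cases "N = 0") (auto simp: F_def mN_def empirical_measure_conv_pmf[of N _ p])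
  have Fm: "(\<lambda>\<omega>. F N (\<lambda>i. \<zeta> i \<omega>)) \<in> borel_measurable (completion M)" for N
  proof (cases "N \<ge> 1")
    case True
    show ?thesis by (rule transfer(1)[OF _ _ True F_cong[OF True]]) blast+
  next
    case False
    then have "N = 0" by simp
    then show ?thesis by (simp add: F_def)
  qed
  have \<zeta>m: "\<zeta> i \<in> borel_measurable M" if "i \<ge> 1" for i
    using indep that by (auto simp: indep_vars_def)
  have fm [measurable]: "?f \<in> borel_measurable borel" by (rule D_measurable[OF mP])
  have Ym: "(\<lambda>\<omega>. Y N (\<lambda>i. \<zeta> i \<omega>)) \<in> borel_measurable M" for N
    unfolding Y_def using \<zeta>m by (intro borel_measurable_divide borel_measurable_sum borel_measurable_diff measurable_compose[OF _ fm]) auto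
  have error: "(\<integral>\<^sup>+\<omega>. ennreal \<bar>F N (\<lambda>i. \<zeta> i \<omega>) - Y N (\<lambda>i. \<zeta> i \<omega>)\<bar> \<partial>completion M) \<le> ennreal (clt_error_bound N)" for N
  proof (cases "N \<ge> 1")
    case True
    have cong: "F N x - Y N x = F N x' - Y N x'" if "\<And>i. 1 \<le> i \<Longrightarrow> i \<le> N \<Longrightarrow> x i = x' i" for x x'
      using F_cong[OF True that] Y_cong[OF True that] by simp
    have "(\<integral>\<^sup>+\<omega>. ennreal \<bar>F N (\<lambda>i. \<zeta> i \<omega>) - Y N (\<lambda>i. \<zeta> i \<omega>)\<bar> \<partial>completion M) =
        (\<integral>\<^sup>+x. ennreal \<bar>F N x - Y N x\<bar> \<partial>Pi_pmf {1..N} 0 (\<lambda>_. p))"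
      by (rule transfer(2)[OF _ _ True cong]) blast+
    also have "\<dots> \<le> ennreal (clt_error_bound N)"
      using nn_integral_clt_error[OF True, of 0] by (simp add: F_def Y_def m0)
    finally show ?thesis .
  next
    case False
    then have "N = 0" by simp
    then show ?thesis by (simp add: F_def Y_def)
  qed

  have E: "expectation (\<lambda>\<omega>. h (\<zeta> 1 \<omega>)) = measure_pmf.expectation p h"
    and Ei: "integrable M (\<lambda>\<omega>. h (\<zeta> 1 \<omega>)) \<longleftrightarrow> integrable (measure_pmf p) h"
    if [measurable]: "h \<in> borel_measurable borel" for h :: "real ^ 'd \<Rightarrow> real"
    using integral_distr[OF \<zeta>m[of 1] that] integrable_distr_eq[OF \<zeta>m[of 1] that] law[of 1]
    by (simp_all add: m0 expectation_borel_pmf)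
  let ?v = "variance (\<lambda>\<omega>. ?f (\<zeta> 1 \<omega>))"
  have v: "?v = measure_pmf.variance p ?f"
    unfolding E[OF fm] by (rule E) simp
  have sq: "integrable (measure_pmf p) (\<lambda>y. (?f y)\<^sup>2)"
    by (rule integrable_D_square[OF mP p_moment])

  \<comment> \<open>The samples are numbered from 1 and the sums of the limit theorem from 0, hence
    \<open>Suc i\<close>.\<close>
  have "weak_conv_m (\<lambda>n. distr M borel (\<lambda>\<omega>. (\<Sum>i<n. ?f (\<zeta> (Suc i) \<omega>) - expectation (\<lambda>\<omega>. ?f (\<zeta> (Suc 0) \<omega>))) / sqrt (real n)))
    (normal_law 0 (variance (\<lambda>\<omega>. ?f (\<zeta> (Suc 0) \<omega>))))"
  proof (rule central_limit_theorem_normal_law)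
    have "indep_vars (\<lambda>_. borel) (\<lambda>i. \<zeta> (Suc i)) UNIV"
      by (rule indep_vars_reindex_inj[of _ _ Suc]) (use indep_vars_subset[OF indep, of "range Suc"] in auto)
    then show "indep_vars (\<lambda>_. borel) (\<lambda>i \<omega>. ?f (\<zeta> (Suc i) \<omega>)) UNIV"
      by (rule indep_vars_compose2) simp
    show "distr M borel (\<lambda>\<omega>. ?f (\<zeta> (Suc n) \<omega>)) = distr m0 borel ?f" for n
      using distr_distr[OF fm \<zeta>m[of "Suc n"]] law[of "Suc n"] by (simp add: comp_def)
    show "integrable M (\<lambda>\<omega>. (?f (\<zeta> (Suc 0) \<omega>))\<^sup>2)"
      using Ei[of "\<lambda>y. (?f y)\<^sup>2"] sq by simp
  qed
  moreover have "(\<Sum>i<n. ?f (\<zeta> (Suc i) \<omega>) - expectation (\<lambda>\<omega>. ?f (\<zeta> (Suc 0) \<omega>))) / sqrt (real n) = Y n (\<lambda>i. \<zeta> i \<omega>)" for n \<omega>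
    using E[OF fm] unfolding Y_def One_nat_def sum.atLeast1_atMost_eq by simp
  ultimately have "weak_conv_m (\<lambda>n. distr (completion M) borel (\<lambda>\<omega>. Y n (\<lambda>i. \<zeta> i \<omega>))) (normal_law 0 ?v)"
    using Ym by (simp add: distr_completion)
  \<comment> \<open>\<open>F\<close> is known to be a random variable only on the completion, so the
    perturbation argument runs there.\<close>
  then have "weak_conv_m (\<lambda>n. distr (completion M) borel (\<lambda>\<omega>. F n (\<lambda>i. \<zeta> i \<omega>))) (normal_law 0 ?v)"
    by (rule Mc.weak_conv_m_L1_perturbation[where e=clt_error_bound, rotated 2])
       (auto intro!: Fm measurable_completion[OF Ym] real_distribution_normal_law variance_positive
          clt_error_bound_nonneg clt_error_bound_tendsto_0 error)
  with Fm have 1: "converges_in_distribution M (\<lambda>N \<omega>. sqrt (real N) * (U (mN N \<omega>) - U m0)) (normal_law 0 ?v)"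
    by (simp add: converges_in_distribution_def X)

  obtain K where K: "\<And>N. clt_error_bound N \<le> K"
    using convergent_imp_Bseq[OF convergentI[OF clt_error_bound_tendsto_0]]
    by (auto simp: Bseq_def intro: order_trans[OF abs_ge_self])
  have "ennreal (sqrt (real N)) * (\<integral>\<^sup>+\<omega>. ennreal \<bar>U (mN N \<omega>) - U m0\<bar> \<partial>completion M) \<le> ennreal (sqrt ?v) + ennreal K"
    if N: "N \<ge> 1" for N
  proof -
    \<comment> \<open>Dividing by \<open>sqrt N\<close> recovers measurability of the difference
      from that of \<open>F\<close>, as needed to move the factor into the integral.\<close>
    have "(\<lambda>\<omega>. \<bar>sqrt (real N) * (U (mN N \<omega>) - U m0)\<bar> / sqrt (real N)) \<in> borel_measurable (completion M)"
      using Fm[of N] unfolding X by simp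
    then have Um: "(\<lambda>\<omega>. \<bar>U (mN N \<omega>) - U m0\<bar>) \<in> borel_measurable (completion M)"
      using N by (simp add: abs_mult)
    have "ennreal (sqrt (real N)) * (\<integral>\<^sup>+\<omega>. ennreal \<bar>U (mN N \<omega>) - U m0\<bar> \<partial>completion M) =
        (\<integral>\<^sup>+\<omega>. ennreal \<bar>F N (\<lambda>i. \<zeta> i \<omega>)\<bar> \<partial>completion M)"
      using Um by (subst nn_integral_cmult[symmetric]) (auto simp: X[symmetric] abs_mult ennreal_mult)
    also have "\<dots> \<le> (\<integral>\<^sup>+\<omega>. ennreal \<bar>Y N (\<lambda>i. \<zeta> i \<omega>)\<bar> + ennreal \<bar>F N (\<lambda>i. \<zeta> i \<omega>) - Y N (\<lambda>i. \<zeta> i \<omega>)\<bar> \<partial>completion M)"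
      by (intro nn_integral_mono) (auto simp flip: ennreal_plus intro!: ennreal_leI)
    also have "\<dots> = (\<integral>\<^sup>+\<omega>. ennreal \<bar>Y N (\<lambda>i. \<zeta> i \<omega>)\<bar> \<partial>completion M) +
        (\<integral>\<^sup>+\<omega>. ennreal \<bar>F N (\<lambda>i. \<zeta> i \<omega>) - Y N (\<lambda>i. \<zeta> i \<omega>)\<bar> \<partial>completion M)"
      using Fm measurable_completion[OF Ym] by (intro nn_integral_add) auto
    also have "(\<integral>\<^sup>+\<omega>. ennreal \<bar>Y N (\<lambda>i. \<zeta> i \<omega>)\<bar> \<partial>completion M) = (\<integral>\<^sup>+x. ennreal \<bar>Y N x\<bar> \<partial>Pi_pmf {1..N} 0 (\<lambda>_. p))"
      by (rule transfer(2)[OF _ _ N Y_cong[OF N]]) blast+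
    also have "\<dots> \<le> ennreal (sqrt ?v)"
      unfolding v Y_def by (rule nn_integral_centred_sum_le[OF sq N])
    also have "(\<integral>\<^sup>+\<omega>. ennreal \<bar>F N (\<lambda>i. \<zeta> i \<omega>) - Y N (\<lambda>i. \<zeta> i \<omega>)\<bar> \<partial>completion M) \<le> ennreal K"
      by (rule order_trans[OF error ennreal_leI[OF K]])
    finally show ?thesis by (simp add: add_mono)
  qed
  then have "(SUP N\<in>{1..}. ennreal (sqrt (real N)) *
      (\<integral>\<^sup>+\<omega>. ennreal \<bar>U (mN N \<omega>) - U m0\<bar> \<partial>completion M)) \<le> ennreal (sqrt ?v) + ennreal K"
    by (intro SUP_least) auto
  also have "\<dots> < \<infinity>" by simp
  finally show ?thesis using 1 by simp
qed

end
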